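(* Let $\mathcal{E}=(L|K,v)$ be an extension of valued fields of prime degree $q=(vL:vK)$, and let $x_0\in L$ be such that $vx_0\notin vK$. For $x\in L$ with $vx\notin vK$ consider the properties $$(P1)\quad\mathcal{O}_L=\bigcup_{c\in K,\ v(cx)>0}\mathcal{O}_K[cx];\qquad(P2)\quad A_x\subseteq\bigcup_{c\in K,\ v(cx)>0}\mathcal{O}_K[cx];$$ (P3) for every element $c_ix^i\in A_x$ (with $c_i\in K^\times$, $1\le i<q$) there is $c\in K$ with $cx\in A_x$ such that $c_ix^i\in(cx)^i\mathcal{O}_K$. 1) If $\mathcal{E}$ is of type (DL2a) or (DL2b), then (P1), (P2), (P3) hold for $x=x_0$. 2) If $\mathcal{E}$ is of type (DL2c), then (P1), (P2), (P3) hold for $x=x_0^j$ with suitable $j\in\{1,\dots,q-1\}$. If in addition $H_{\mathcal{E}}=\{0\}$, then $\mathcal{O}_L=\mathcal{O}_K[cx]$ for suitable $c\in K$. The assumption of part 1) holds in particular when every archimedean component of $vK$ is dense, and this in turn holds for every deeply ramified field $(K,v)$. In all cases (with $x=x_0$ in part 1) and $x=x_0^j$ in part 2)), $1,x,\dots,x^{q-1}$ form a valuation basis of $(L|K,v)$, and for all $c,c'\in K$, $$\mathcal{O}_K[cx]\subseteq\mathcal{O}_K[c'x]\iff vc\ge vc'.$$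
   Context: Valuations are Krull valuations of arbitrary rank. $(L|K,v)$ denotes a field extension $L|K$ with a valuation $v$ on $L$, $K$ being endowed with the restriction of $v$. $\mathcal{O}_K,\mathcal{O}_L$ are the valuation rings, $vK,vL$ the value groups, $vx$ the value of $x$, $Kv$ the residue field of $(K,v)$. Elements $a_1,\dots,a_q$ form a valuation basis of $(L|K,v)$ if they form a $K$-basis of $L$ and $v(\sum_ic_ia_i)=\min_iv(c_ia_i)$ for all $c_i\in K$. For $x\in L$ with $vx\notin vK$ put $A_x=\{c_ix^i\mid c_i\in K^\times\text{ and }1\le i<q\text{ such that }v(c_ix^i)>0\}$. $H_{\mathcal{E}}$ is the largest convex subgroup of $vL$ which is also a convex subgroup of $vK$. The extension $\mathcal{E}$ is of type (DL2a) if there is no smallest convex subgroup of $vL$ properly containing $H_{\mathcal{E}}$; of type (DL2b) if there is a smallest convex subgroup $\tilde H_{\mathcal{E}}$ of $vL$ properly containing $H_{\mathcal{E}}$ and $\tilde H_{\mathcal{E}}/H_{\mathcal{E}}$ is dense; of type (DL2c) if such $\tilde H_{\mathcal{E}}$ exists and $\tilde H_{\mathcal{E}}/H_{\mathcal{E}}$ is discrete. An ordered abelian group is discrete if it has a smallest positive element, and dense if it is nonzero and strictly between any two distinct elements there lies a third. For $0\ne\gamma\in\Gamma$ ($\Gamma$ an ordered abelian group), the archimedean component of $\Gamma$ associated with $\gamma$ is the quotient of the smallest convex subgroup containing $\gamma$ by the largest convex subgroup not containing $\gamma$. A nontrivially valued field $(K,v)$ is called deeply ramified if: (DRvg) whenever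 $\Gamma_1\subsetneq\Gamma_2$ are convex subgroups of $vK$, then $\Gamma_2/\Gamma_1\not\cong\mathbb{Z}$; and (DRvr) if $\mathrm{char}\,Kv=p>0$, then $x\mapsto x^p$ is surjective on $\mathcal{O}_{\hat K}/p\mathcal{O}_{\hat K}$, where $\hat K$ is the completion of $(K,v)$ for the valuation topology and $\mathcal{O}_{\hat K}$ its valuation ring.
   Formalization: The last equivalence fails for some c, c' (K=Q_p, x=√p, c=p^-2, c'=p^-1: both rings equal L); it is proved for c' with v(c'x)>0 and arbitrary c, while vc ≥ vc' implies O_K[cx] ⊆ O_K[c'x] is proved for all c, c' in K. *)

theory Defs
  imports "HOL-Algebra.Algebra" "HOL-Library.Extended" "HOL-Computational_Algebra.Primes"
begin

section \<open>Ordered abelian groups\<close>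

text \<open>Ordered abelian groups are subgroups \<open>\<Gamma>\<close> of an arbitrary linearly ordered abelian group
  \<open>'g\<close>, with the induced order.\<close>

definition oag :: "'g::linordered_ab_group_add set \<Rightarrow> 'g monoid" where
  "oag \<Gamma> = \<lparr>carrier = \<Gamma>, monoid.mult = (+), one = 0\<rparr>"

definition convex_subgroup :: "'g::linordered_ab_group_add set \<Rightarrow> 'g set \<Rightarrow> bool" where
  "convex_subgroup \<Gamma> H \<longleftrightarrow> subgroup H (oag \<Gamma>) \<and>
     (\<forall>a\<in>H. \<forall>b\<in>H. \<forall>c\<in>\<Gamma>. a \<le> c \<and> c \<le> b \<longrightarrow> c \<in> H)"

text \<open>The strict order which a quotient by a convex subgroup inherits, as a relation on cosets.\<close>

definition coset_less :: "'g::linordered_ab_group_add set \<Rightarrow> 'g set \<Rightarrow> bool" where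
  "coset_less A B \<longleftrightarrow> A \<noteq> B \<and> (\<exists>a\<in>A. \<exists>b\<in>B. a \<le> b)"

definition discrete_ordered :: "('c, 'm) monoid_scheme \<Rightarrow> ('c \<Rightarrow> 'c \<Rightarrow> bool) \<Rightarrow> bool" where
  "discrete_ordered G lt \<longleftrightarrow>
     (\<exists>e\<in>carrier G. lt \<one>\<^bsub>G\<^esub> e \<and> (\<forall>a\<in>carrier G. lt \<one>\<^bsub>G\<^esub> a \<longrightarrow> e = a \<or> lt e a))"

definition dense_ordered :: "('c, 'm) monoid_scheme \<Rightarrow> ('c \<Rightarrow> 'c \<Rightarrow> bool) \<Rightarrow> bool" where
  "dense_ordered G lt \<longleftrightarrow> carrier G \<noteq> {\<one>\<^bsub>G\<^esub>} \<and>
     (\<forall>a\<in>carrier G. \<forall>b\<in>carrier G. lt a b \<longrightarrow> (\<exists>c\<in>carrier G. lt a c \<and> lt c b))"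

text \<open>The convex subgroups of \<open>\<Gamma>\<close> form a chain closed under unions and (nonempty) intersections,
  so the least and greatest elements below exist.\<close>

definition archimedean_component :: "'g::linordered_ab_group_add set \<Rightarrow> 'g \<Rightarrow> 'g set monoid" where
  "archimedean_component \<Gamma> \<gamma> =
     oag (LEAST C. convex_subgroup \<Gamma> C \<and> \<gamma> \<in> C) Mod (GREATEST C. convex_subgroup \<Gamma> C \<and> \<gamma> \<notin> C)"

definition archimedean_components_dense :: "'g::linordered_ab_group_add set \<Rightarrow> bool" where
  "archimedean_components_dense \<Gamma> \<longleftrightarrow>
     (\<forall>\<gamma>\<in>\<Gamma>. \<gamma> \<noteq> 0 \<longrightarrow> dense_ordered (archimedean_component \<Gamma> \<gamma>) coset_less)"


section \<open>Valued fields\<close>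

text \<open>The values lie in \<open>'g\<close> together with \<open>\<infinity>\<close>; the element \<open>-\<infinity>\<close> of
  \<^typ>\<open>'g extended\<close> is not a value.  The valuation need not be onto \<open>'g\<close>.\<close>

locale valued_field = field F for F :: "('a, 'm) ring_scheme" (structure) +
  fixes v :: "'a \<Rightarrow> 'g::linordered_ab_group_add extended"
  assumes v_not_Minf: "x \<in> carrier F \<Longrightarrow> v x \<noteq> -\<infinity>"
    and v_eq_Pinf: "x \<in> carrier F \<Longrightarrow> v x = \<infinity> \<longleftrightarrow> x = \<zero>"
    and v_mult: "x \<in> carrier F \<Longrightarrow> y \<in> carrier F \<Longrightarrow> v (x \<otimes> y) = v x + v y"
    and v_add: "x \<in> carrier F \<Longrightarrow> y \<in> carrier F \<Longrightarrow> min (v x) (v y) \<le> v (x \<oplus> y)"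

definition value_group ::
    "('a, 'm) ring_scheme \<Rightarrow> ('a \<Rightarrow> 'g::linordered_ab_group_add extended) \<Rightarrow> 'g set" where
  "value_group F v = {\<gamma>. \<exists>x\<in>carrier F. x \<noteq> \<zero>\<^bsub>F\<^esub> \<and> v x = Fin \<gamma>}"

definition valuation_ring ::
    "('a, 'm) ring_scheme \<Rightarrow> ('a \<Rightarrow> 'g::linordered_ab_group_add extended) \<Rightarrow> 'a set" where
  "valuation_ring F v = {x \<in> carrier F. 0 \<le> v x}"

definition residue_field ::
    "('a, 'm) ring_scheme \<Rightarrow> ('a \<Rightarrow> 'g::linordered_ab_group_add extended) \<Rightarrow> 'a set ring" where
  "residue_field F v = F\<lparr>carrier := valuation_ring F v\<rparr> Quot {x \<in> carrier F. 0 < v x}"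

definition ring_characteristic :: "('a, 'm) ring_scheme \<Rightarrow> nat" where
  "ring_characteristic R = group.ord (add_monoid R) \<one>\<^bsub>R\<^esub>"


subsection \<open>Completion\<close>

text \<open>The completion is constructed as the ring of Cauchy nets modulo the ideal of null nets.  The
  value group indexes a base of neighbourhoods of zero, so nets indexed by the value group suffice.
  A net is a total function on \<open>'g\<close>, but its values outside the value group are irrelevant: they
  play no role in the Cauchy condition and disappear modulo null nets.\<close>

definition eventually_vg :: "('a, 'm) ring_scheme \<Rightarrow> ('a \<Rightarrow> 'g::linordered_ab_group_add extended)
    \<Rightarrow> ('g \<Rightarrow> bool) \<Rightarrow> bool" where
  "eventually_vg F v P \<longleftrightarrow>
     (\<exists>\<gamma>\<^sub>0\<in>value_group F v. \<forall>\<gamma>\<in>value_group F v. \<gamma>\<^sub>0 \<le> \<gamma> \<longrightarrow> P \<gamma>)"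

definition cauchy_nets ::
    "('a, 'm) ring_scheme \<Rightarrow> ('a \<Rightarrow> 'g::linordered_ab_group_add extended) \<Rightarrow> ('g \<Rightarrow> 'a) set" where
  "cauchy_nets F v = {a \<in> UNIV \<rightarrow> carrier F. \<forall>\<epsilon>\<in>value_group F v.
     \<exists>\<gamma>\<^sub>0\<in>value_group F v. \<forall>\<gamma>\<in>value_group F v. \<forall>\<delta>\<in>value_group F v.
       \<gamma>\<^sub>0 \<le> \<gamma> \<and> \<gamma>\<^sub>0 \<le> \<delta> \<longrightarrow> Fin \<epsilon> < v (a \<gamma> \<ominus>\<^bsub>F\<^esub> a \<delta>)}"

definition null_nets ::
    "('a, 'm) ring_scheme \<Rightarrow> ('a \<Rightarrow> 'g::linordered_ab_group_add extended) \<Rightarrow> ('g \<Rightarrow> 'a) set" where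
  "null_nets F v = {a \<in> UNIV \<rightarrow> carrier F. \<forall>\<epsilon>\<in>value_group F v.
     eventually_vg F v (\<lambda>\<gamma>. Fin \<epsilon> < v (a \<gamma>))}"

definition cauchy_ring ::
    "('a, 'm) ring_scheme \<Rightarrow> ('a \<Rightarrow> 'g::linordered_ab_group_add extended) \<Rightarrow> ('g \<Rightarrow> 'a) ring" where
  "cauchy_ring F v = \<lparr>carrier = cauchy_nets F v,
     monoid.mult = (\<lambda>a b \<gamma>. a \<gamma> \<otimes>\<^bsub>F\<^esub> b \<gamma>), one = (\<lambda>_. \<one>\<^bsub>F\<^esub>),
     ring.zero = (\<lambda>_. \<zero>\<^bsub>F\<^esub>), ring.add = (\<lambda>a b \<gamma>. a \<gamma> \<oplus>\<^bsub>F\<^esub> b \<gamma>)\<rparr>"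

definition completion ::
    "('a, 'm) ring_scheme \<Rightarrow> ('a \<Rightarrow> 'g::linordered_ab_group_add extended) \<Rightarrow> ('g \<Rightarrow> 'a) set ring" where
  "completion F v = cauchy_ring F v Quot null_nets F v"

text \<open>Along a Cauchy net that is not null the values are eventually constant, and the constant
  depends only on the class of the net.  The zero class contains the zero net, of value \<open>\<infinity>\<close>.\<close>

definition completion_valuation ::
    "('a, 'm) ring_scheme \<Rightarrow> ('a \<Rightarrow> 'g::linordered_ab_group_add extended)
      \<Rightarrow> ('g \<Rightarrow> 'a) set \<Rightarrow> 'g extended" where
  "completion_valuation F v A = (THE g. \<exists>a\<in>A. eventually_vg F v (\<lambda>\<gamma>. v (a \<gamma>) = g))"


subsection \<open>Deeply ramified fields\<close>

definition DRvg ::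
    "('a, 'm) ring_scheme \<Rightarrow> ('a \<Rightarrow> 'g::linordered_ab_group_add extended) \<Rightarrow> bool" where
  "DRvg F v \<longleftrightarrow> (\<forall>\<Gamma>\<^sub>1 \<Gamma>\<^sub>2. convex_subgroup (value_group F v) \<Gamma>\<^sub>1 \<and>
     convex_subgroup (value_group F v) \<Gamma>\<^sub>2 \<and> \<Gamma>\<^sub>1 \<subset> \<Gamma>\<^sub>2 \<longrightarrow> \<not> oag \<Gamma>\<^sub>2 Mod \<Gamma>\<^sub>1 \<cong> integer_group)"

definition frobenius_surjective_mod :: "nat \<Rightarrow> ('a, 'm) ring_scheme \<Rightarrow> bool" where
  "frobenius_surjective_mod p R \<longleftrightarrow>
     (let Q = R Quot (PIdl\<^bsub>R\<^esub> ([p] \<cdot>\<^bsub>R\<^esub> \<one>\<^bsub>R\<^esub>)) in (\<lambda>x. x [^]\<^bsub>Q\<^esub> p) ` carrier Q = carrier Q)"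

definition DRvr ::
    "('a, 'm) ring_scheme \<Rightarrow> ('a \<Rightarrow> 'g::linordered_ab_group_add extended) \<Rightarrow> bool" where
  "DRvr F v \<longleftrightarrow> (\<forall>p. ring_characteristic (residue_field F v) = p \<and> p > 0 \<longrightarrow>
     frobenius_surjective_mod p
       ((completion F v)\<lparr>carrier := valuation_ring (completion F v) (completion_valuation F v)\<rparr>))"

definition deeply_ramified ::
    "('a, 'm) ring_scheme \<Rightarrow> ('a \<Rightarrow> 'g::linordered_ab_group_add extended) \<Rightarrow> bool" where
  "deeply_ramified F v \<longleftrightarrow>
     valued_field F v \<and> value_group F v \<noteq> {0} \<and> DRvg F v \<and> DRvr F v"


section \<open>Extensions of valued fields\<close>

text \<open>\<open>K\<close> is a subfield of \<open>L\<close>, regarded as the ring \<^term>\<open>L\<lparr>carrier := K\<rparr>\<close>;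
  its valuation is the restriction of \<open>v\<close>.\<close>

abbreviation value_group_sub ::
    "('a, 'm) ring_scheme \<Rightarrow> 'a set \<Rightarrow> ('a \<Rightarrow> 'g::linordered_ab_group_add extended) \<Rightarrow> 'g set" where
  "value_group_sub L K v \<equiv> value_group (L\<lparr>carrier := K\<rparr>) v"

abbreviation valuation_ring_sub ::
    "('a, 'm) ring_scheme \<Rightarrow> 'a set \<Rightarrow> ('a \<Rightarrow> 'g::linordered_ab_group_add extended) \<Rightarrow> 'a set" where
  "valuation_ring_sub L K v \<equiv> valuation_ring (L\<lparr>carrier := K\<rparr>) v"

definition value_group_index ::
    "('a, 'm) ring_scheme \<Rightarrow> 'a set \<Rightarrow> ('a \<Rightarrow> 'g::linordered_ab_group_add extended) \<Rightarrow> nat" where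
  "value_group_index L K v = card (rcosets\<^bsub>oag (value_group L v)\<^esub> (value_group_sub L K v))"

definition valuation_basis :: "('a, 'm) ring_scheme \<Rightarrow> 'a set
    \<Rightarrow> ('a \<Rightarrow> 'g::linordered_ab_group_add extended) \<Rightarrow> 'a list \<Rightarrow> bool" where
  "valuation_basis L K v as \<longleftrightarrow>
     set as \<subseteq> carrier L \<and> ring.independent L K as \<and> ring.Span L K as = carrier L \<and>
     (\<forall>cs. set cs \<subseteq> K \<and> length cs = length as \<longrightarrow>
        v (ring.combine L cs as) = Min (set (map2 (\<lambda>c a. v (c \<otimes>\<^bsub>L\<^esub> a)) cs as)))"


subsection \<open>Types of extensions\<close>

definition H_core ::
    "('a, 'm) ring_scheme \<Rightarrow> 'a set \<Rightarrow> ('a \<Rightarrow> 'g::linordered_ab_group_add extended) \<Rightarrow> 'g set" where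
  "H_core L K v = (GREATEST H. convex_subgroup (value_group L v) H \<and>
     convex_subgroup (value_group_sub L K v) H)"

definition is_H_tilde :: "('a, 'm) ring_scheme \<Rightarrow> 'a set
    \<Rightarrow> ('a \<Rightarrow> 'g::linordered_ab_group_add extended) \<Rightarrow> 'g set \<Rightarrow> bool" where
  "is_H_tilde L K v C \<longleftrightarrow> convex_subgroup (value_group L v) C \<and> H_core L K v \<subset> C \<and>
     (\<forall>D. convex_subgroup (value_group L v) D \<and> H_core L K v \<subset> D \<longrightarrow> C \<subseteq> D)"

definition DL2a ::
    "('a, 'm) ring_scheme \<Rightarrow> 'a set \<Rightarrow> ('a \<Rightarrow> 'g::linordered_ab_group_add extended) \<Rightarrow> bool" where
  "DL2a L K v \<longleftrightarrow> (\<nexists>C. is_H_tilde L K v C)"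

definition DL2b ::
    "('a, 'm) ring_scheme \<Rightarrow> 'a set \<Rightarrow> ('a \<Rightarrow> 'g::linordered_ab_group_add extended) \<Rightarrow> bool" where
  "DL2b L K v \<longleftrightarrow>
     (\<exists>C. is_H_tilde L K v C \<and> dense_ordered (oag C Mod H_core L K v) coset_less)"

definition DL2c ::
    "('a, 'm) ring_scheme \<Rightarrow> 'a set \<Rightarrow> ('a \<Rightarrow> 'g::linordered_ab_group_add extended) \<Rightarrow> bool" where
  "DL2c L K v \<longleftrightarrow>
     (\<exists>C. is_H_tilde L K v C \<and> discrete_ordered (oag C Mod H_core L K v) coset_less)"


subsection \<open>The properties of a generator\<close>

text \<open>\<open>O_adjoin L K v y\<close> is \<open>\<O>\<^sub>K[y]\<close>.\<close>

abbreviation O_adjoin :: "('a, 'm) ring_scheme \<Rightarrow> 'a set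
    \<Rightarrow> ('a \<Rightarrow> 'g::linordered_ab_group_add extended) \<Rightarrow> 'a \<Rightarrow> 'a set" where
  "O_adjoin L K v y \<equiv> ring.simple_extension L (valuation_ring_sub L K v) y"

definition O_adjoin_union :: "('a, 'm) ring_scheme \<Rightarrow> 'a set
    \<Rightarrow> ('a \<Rightarrow> 'g::linordered_ab_group_add extended) \<Rightarrow> 'a \<Rightarrow> 'a set" where
  "O_adjoin_union L K v x =
     (\<Union>c\<in>{c\<in>K. 0 < v (c \<otimes>\<^bsub>L\<^esub> x)}. O_adjoin L K v (c \<otimes>\<^bsub>L\<^esub> x))"

definition A_set :: "('a, 'm) ring_scheme \<Rightarrow> 'a set
    \<Rightarrow> ('a \<Rightarrow> 'g::linordered_ab_group_add extended) \<Rightarrow> nat \<Rightarrow> 'a \<Rightarrow> 'a set" where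
  "A_set L K v q x = {c \<otimes>\<^bsub>L\<^esub> x [^]\<^bsub>L\<^esub> i | c i.
     c \<in> K - {\<zero>\<^bsub>L\<^esub>} \<and> 1 \<le> i \<and> i < q \<and> 0 < v (c \<otimes>\<^bsub>L\<^esub> x [^]\<^bsub>L\<^esub> i)}"

definition P1 :: "('a, 'm) ring_scheme \<Rightarrow> 'a set
    \<Rightarrow> ('a \<Rightarrow> 'g::linordered_ab_group_add extended) \<Rightarrow> 'a \<Rightarrow> bool" where
  "P1 L K v x \<longleftrightarrow> valuation_ring L v = O_adjoin_union L K v x"

definition P2 :: "('a, 'm) ring_scheme \<Rightarrow> 'a set
    \<Rightarrow> ('a \<Rightarrow> 'g::linordered_ab_group_add extended) \<Rightarrow> nat \<Rightarrow> 'a \<Rightarrow> bool" where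
  "P2 L K v q x \<longleftrightarrow> A_set L K v q x \<subseteq> O_adjoin_union L K v x"

definition P3 :: "('a, 'm) ring_scheme \<Rightarrow> 'a set
    \<Rightarrow> ('a \<Rightarrow> 'g::linordered_ab_group_add extended) \<Rightarrow> nat \<Rightarrow> 'a \<Rightarrow> bool" where
  "P3 L K v q x \<longleftrightarrow>
     (\<forall>d\<in>K - {\<zero>\<^bsub>L\<^esub>}. \<forall>i. 1 \<le> i \<and> i < q \<and> d \<otimes>\<^bsub>L\<^esub> x [^]\<^bsub>L\<^esub> i \<in> A_set L K v q x \<longrightarrow>
        (\<exists>c\<in>K. c \<otimes>\<^bsub>L\<^esub> x \<in> A_set L K v q x \<and>
           d \<otimes>\<^bsub>L\<^esub> x [^]\<^bsub>L\<^esub> i \<in> (\<lambda>a. (c \<otimes>\<^bsub>L\<^esub> x) [^]\<^bsub>L\<^esub> i \<otimes>\<^bsub>L\<^esub> a) ` valuation_ring_sub L K v))"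

text \<open>The inclusion \<open>\<O>\<^sub>K[cx] \<subseteq> \<O>\<^sub>K[c'x]\<close> is equivalent to \<open>vc \<ge> vc'\<close> only when \<open>c'x\<close> has positive
  value: for \<open>K = \<rat>\<^sub>p\<close> and \<open>x\<^sup>2 = p\<close>, both \<open>\<O>\<^sub>K[x/p]\<close> and \<open>\<O>\<^sub>K[x/p\<^sup>2]\<close> are all of \<open>L\<close>.
  The implication from right to left needs no restriction.\<close>

definition O_adjoin_ordered :: "('a, 'm) ring_scheme \<Rightarrow> 'a set
    \<Rightarrow> ('a \<Rightarrow> 'g::linordered_ab_group_add extended) \<Rightarrow> 'a \<Rightarrow> bool" where
  "O_adjoin_ordered L K v x \<longleftrightarrow>
     (\<forall>c\<in>K. \<forall>c'\<in>K. v c \<ge> v c' \<longrightarrow> O_adjoin L K v (c \<otimes>\<^bsub>L\<^esub> x) \<subseteq> O_adjoin L K v (c' \<otimes>\<^bsub>L\<^esub> x)) \<and>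
     (\<forall>c\<in>K. \<forall>c'\<in>K. 0 < v (c' \<otimes>\<^bsub>L\<^esub> x) \<longrightarrow>
        (O_adjoin L K v (c \<otimes>\<^bsub>L\<^esub> x) \<subseteq> O_adjoin L K v (c' \<otimes>\<^bsub>L\<^esub> x) \<longleftrightarrow> v c \<ge> v c'))"

end

theory Submission
  imports Defs
begin

text \<open>Let \<open>\<Delta>\<close> and \<open>\<Gamma>\<close> be the value groups of \<open>K\<close> and \<open>L\<close>, let \<open>\<xi> = vx\<close> and let \<open>H\<close> be the largest convex
  subgroup of \<open>\<Gamma>\<close> contained in \<open>\<Delta>\<close>.  Since \<open>\<Gamma>/\<Delta>\<close> has prime order \<open>q\<close>, the values of
  \<open>1, x, \<dots>, x\<^bsup>q-1\<^esup>\<close> lie in distinct cosets of \<open>\<Delta>\<close>, so these powers form a valuation basis, and everything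
  reduces to (P3), i.e. to: every \<open>\<alpha> > 0\<close> in \<open>i\<xi> + \<Delta>\<close>, \<open>1 \<le> i < q\<close>, admits a \<open>\<beta> > 0\<close> in \<open>\<xi> + \<Delta>\<close> with \<open>i\<beta> \<le> \<alpha>\<close>.
  Such an \<open>\<alpha>\<close> is not in \<open>H\<close>.  If some convex subgroup strictly above \<open>H\<close> omits \<open>\<alpha>\<close>, it meets \<open>\<xi> + \<Delta>\<close>,
  and any positive \<open>\<beta>\<close> in the intersection works.  Otherwise \<open>\<alpha>\<close> lies in the smallest convex subgroup above
  \<open>H\<close>, whose quotient by \<open>H\<close> is archimedean.  If the quotient is dense, \<open>\<beta>\<close> is obtained by reducing an element of
  \<open>\<xi> + \<Delta>\<close> modulo \<open>q\<gamma> \<in> \<Delta>\<close> for a very small \<open>\<gamma> > 0\<close>; if it is generated by \<open>e + H\<close>, one takes for \<open>x\<close> the power of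
  \<open>x\<^sub>0\<close> whose value is congruent to \<open>e\<close>, and \<open>\<beta> = e - h\<close> with \<open>h \<in> H\<close>.\<close>

section \<open>Convex subgroups\<close>

primrec nsmul :: "nat \<Rightarrow> 'g::linordered_ab_group_add \<Rightarrow> 'g" where
  "nsmul 0 a = 0"
| "nsmul (Suc n) a = a + nsmul n a"

lemma nsmul_one [simp]: "nsmul 1 a = a"
  by simp

lemma nsmul_add: "nsmul (m + n) a = nsmul m a + nsmul n a"
  by (induction m) (auto simp: add.assoc)

lemma nsmul_distrib: "nsmul n (a + b) = nsmul n a + nsmul n b"
  by (induction n) (auto simp: algebra_simps)

lemma nsmul_minus: "nsmul n (- a) = - nsmul n a"
  by (induction n) auto

lemma nsmul_diff: "nsmul n (a - b) = nsmul n a - nsmul n b"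
  using nsmul_distrib[of n a "- b"] by (simp add: nsmul_minus)

lemma nsmul_nsmul: "nsmul m (nsmul n a) = nsmul (m * n) a"
  by (induction m) (auto simp: nsmul_add)

lemma nsmul_nonneg: "0 \<le> a \<Longrightarrow> 0 \<le> nsmul n a"
  by (induction n) auto

lemma nsmul_mono: "a \<le> b \<Longrightarrow> nsmul n a \<le> nsmul n b"
  by (induction n) (auto intro: add_mono)

lemma nsmul_mono_left: "0 \<le> a \<Longrightarrow> m \<le> n \<Longrightarrow> nsmul m a \<le> nsmul n a"
  by (metis add.right_neutral add_left_mono le_add_diff_inverse nsmul_add nsmul_nonneg)

lemma nsmul_strict_mono: "a < b \<Longrightarrow> 0 < n \<Longrightarrow> nsmul n a < nsmul n b"
  by (cases n) (auto intro: add_less_le_mono nsmul_mono less_imp_le)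

lemma le_nsmul: "0 \<le> a \<Longrightarrow> 1 \<le> n \<Longrightarrow> a \<le> nsmul n a"
  using nsmul_mono_left[of a 1 n] by simp

definition oabs :: "'g::linordered_ab_group_add \<Rightarrow> 'g" where
  "oabs a = (if 0 \<le> a then a else - a)"

lemma oabs_nonneg [simp]: "0 \<le> oabs a"
  by (auto simp: oabs_def)

lemma oabs_eq [simp]: "0 \<le> a \<Longrightarrow> oabs a = a"
  by (auto simp: oabs_def)

lemma oabs_pos: "a \<noteq> 0 \<Longrightarrow> 0 < oabs a"
  by (auto simp: oabs_def)

lemma oabs_zero [simp]: "oabs 0 = 0"
  by (auto simp: oabs_def)

lemma le_oabs: "a \<le> oabs a" "- a \<le> oabs a"
  by (auto simp: oabs_def)

lemma oabs_le: "a \<le> b \<Longrightarrow> - a \<le> b \<Longrightarrow> oabs a \<le> b"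
  by (auto simp: oabs_def)

lemma oabs_minus [simp]: "oabs (- a) = oabs a"
  by (auto simp: oabs_def)

lemma oabs_add: "oabs (a + b) \<le> oabs a + oabs b"
  using add_mono[OF le_oabs(1)[of a] le_oabs(1)[of b]] add_mono[OF le_oabs(2)[of a] le_oabs(2)[of b]]
  by (intro oabs_le) auto

lemma oabs_diff: "oabs (a - b) \<le> oabs a + oabs b"
  using oabs_add[of a "- b"] by simp

section \<open>Subgroups of the ambient ordered group\<close>

lemma group_oag_UNIV: "group (oag UNIV)"
  by (rule groupI) (auto simp: oag_def add.assoc intro: exI[of _ "- _"] left_minus)

lemma inv_oag_UNIV: "inv\<^bsub>oag UNIV\<^esub> a = - a"
  by (rule group.inv_equality[OF group_oag_UNIV]) (auto simp: oag_def)

text \<open>Value groups and their convex subgroups are all treated as subgroups of the one group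
  \<open>'g\<close>, so that nested groups share one predicate; \<open>subgroup_oag_iff\<close>
  translates back to subgroups of \<open>oag G\<close>.\<close>

abbreviation ogroup :: "'g::linordered_ab_group_add set \<Rightarrow> bool" where
  "ogroup H \<equiv> subgroup H (oag UNIV)"

lemma ogroupI:
  assumes "0 \<in> H" "\<And>a b. a \<in> H \<Longrightarrow> b \<in> H \<Longrightarrow> a - b \<in> H"
  shows "ogroup H"
proof -
  have m: "- a \<in> H" if "a \<in> H" for a
    using assms(2)[OF assms(1) that] by simp
  have "a + b \<in> H" if "a \<in> H" "b \<in> H" for a b
    using assms(2)[OF that(1) m[OF that(2)]] by simp
  with m assms(1) show ?thesis
    by (intro subgroup.intro) (simp_all add: inv_oag_UNIV, simp_all add: oag_def)
qed

lemma ogroup_zero: "ogroup H \<Longrightarrow> 0 \<in> H"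
  using subgroup.one_closed[of H "oag UNIV"] by (simp add: oag_def)

lemma ogroup_add: "ogroup H \<Longrightarrow> a \<in> H \<Longrightarrow> b \<in> H \<Longrightarrow> a + b \<in> H"
  using subgroup.m_closed[of H "oag UNIV"] by (simp add: oag_def)

lemma ogroup_minus: "ogroup H \<Longrightarrow> a \<in> H \<Longrightarrow> - a \<in> H"
  using subgroup.m_inv_closed[of H "oag UNIV"] by (simp add: inv_oag_UNIV)

lemma ogroup_diff: "ogroup H \<Longrightarrow> a \<in> H \<Longrightarrow> b \<in> H \<Longrightarrow> a - b \<in> H"
  using ogroup_add[of H a "- b"] ogroup_minus[of H b] by simp

lemma ogroup_nsmul: "ogroup H \<Longrightarrow> a \<in> H \<Longrightarrow> nsmul n a \<in> H"
  by (induction n) (auto intro: ogroup_add ogroup_zero)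

lemma ogroup_oabs: "ogroup H \<Longrightarrow> oabs a \<in> H \<longleftrightarrow> a \<in> H"
  using ogroup_minus[of H a] ogroup_minus[of H "- a"] by (auto simp: oabs_def)

lemmas ogroup_closed = ogroup_zero ogroup_add ogroup_minus ogroup_diff ogroup_nsmul

lemma ogroup_diff_swap: "ogroup H \<Longrightarrow> a - b \<in> H \<longleftrightarrow> b - a \<in> H"
  by (metis minus_diff_eq ogroup_minus)

lemma ogroup_add_cancel: "ogroup H \<Longrightarrow> b \<in> H \<Longrightarrow> a + b \<in> H \<longleftrightarrow> a \<in> H"
  using ogroup_add[of H a b] ogroup_diff[of H "a + b" b] by auto

lemma comm_group_oag:
  assumes "ogroup G"
  shows "comm_group (oag G)"
proof -
  have "\<exists>y\<in>G. y + x = 0" if "x \<in> G" for x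
    using ogroup_minus[OF assms that] by (intro bexI[of _ "- x"]) auto
  then show ?thesis
    using ogroup_zero[OF assms] ogroup_add[OF assms]
    by (intro comm_groupI) (auto simp: oag_def add.assoc add.commute)
qed

lemma carrier_oag [simp]: "carrier (oag G) = G"
  and mult_oag [simp]: "a \<otimes>\<^bsub>oag G\<^esub> b = a + b"
  and one_oag [simp]: "\<one>\<^bsub>oag G\<^esub> = 0"
  by (simp_all add: oag_def)

lemma inv_oag: "ogroup G \<Longrightarrow> a \<in> G \<Longrightarrow> inv\<^bsub>oag G\<^esub> a = - a"
  by (rule group.inv_equality) (auto intro: comm_group.axioms(2) comm_group_oag ogroup_minus)

lemma pow_oag: "a [^]\<^bsub>oag G\<^esub> (n::nat) = nsmul n a"
  by (induction n) (auto simp: nat_pow_def add.commute)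

lemma subgroup_oag_iff:
  assumes "ogroup G"
  shows "subgroup H (oag G) \<longleftrightarrow> H \<subseteq> G \<and> ogroup H"
proof
  assume H: "subgroup H (oag G)"
  note sub = subgroup.subset[OF H, simplified]
  have "a - b \<in> H" if "a \<in> H" "b \<in> H" for a b
    using subgroup.m_closed[OF H that(1) subgroup.m_inv_closed[OF H that(2)]]
      inv_oag[OF assms, of b] that sub by auto
  moreover have "0 \<in> H"
    using subgroup.one_closed[OF H] by simp
  ultimately show "H \<subseteq> G \<and> ogroup H"
    using sub ogroupI by blast
next
  assume "H \<subseteq> G \<and> ogroup H"
  then show "subgroup H (oag G)"
    by (intro subgroup.intro) (auto simp: inv_oag[OF assms] subset_iff intro: ogroup_closed)
qed

section \<open>Convex subgroups and their chain property\<close>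

text \<open>Translating an interval with endpoints in \<open>H\<close> by its left endpoint makes it
  start at 0, so convexity has to be tested on such intervals only.\<close>

lemma convex_subgroupI:
  assumes "ogroup G" "H \<subseteq> G" "ogroup H"
    and "\<And>a c. a \<in> H \<Longrightarrow> c \<in> G \<Longrightarrow> 0 \<le> c \<Longrightarrow> c \<le> a \<Longrightarrow> c \<in> H"
  shows "convex_subgroup G H"
proof -
  have "c \<in> H" if "a \<in> H" "b \<in> H" "c \<in> G" "a \<le> c" "c \<le> b" for a b c
  proof -
    have "c - a \<in> G" "b - a \<in> H"
      using assms(1-3) that ogroup_diff by blast+
    then have "c - a \<in> H"
      using assms(4)[of "b - a" "c - a"] that by simp
    with that show ?thesis
      using ogroup_add[OF assms(3)] by fastforce
  qed
  with assms(1-3) show ?thesis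
    unfolding convex_subgroup_def subgroup_oag_iff[OF assms(1)] by blast
qed

lemma convex_subgroupD:
  assumes "ogroup G" "convex_subgroup G H"
  shows "H \<subseteq> G" "ogroup H" "subgroup H (oag G)"
  using assms unfolding convex_subgroup_def by (auto simp: subgroup_oag_iff)

lemma convex_subgroup_oabs:
  assumes "ogroup G" "convex_subgroup G H" "a \<in> H" "c \<in> G" "oabs c \<le> oabs a"
  shows "c \<in> H"
proof -
  note H = convex_subgroupD[OF assms(1,2)]
  have "oabs a \<in> H" "0 \<in> H" "oabs c \<in> G"
    using assms H ogroup_oabs ogroup_zero by auto
  then have "oabs c \<in> H"
    using assms(2,5) unfolding convex_subgroup_def by (meson oabs_nonneg)
  then show ?thesis
    using H ogroup_oabs by blast
qed

text \<open>Given an element of each group outside the other, the one of smaller absolute value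
  would lie in both groups by convexity.\<close>

lemma convex_subgroup_chain:
  assumes "ogroup G" "convex_subgroup G A" "convex_subgroup G B"
  shows "A \<subseteq> B \<or> B \<subseteq> A"
proof (rule ccontr)
  assume "\<not> ?thesis"
  then obtain a b where ab: "a \<in> A" "a \<notin> B" "b \<in> B" "b \<notin> A" by blast
  then have "a \<in> G" "b \<in> G"
    using assms convex_subgroupD by blast+
  then show False
    using ab convex_subgroup_oabs[OF assms(1,2), of a b] convex_subgroup_oabs[OF assms(1,3), of b a]
      linear[of "oabs a" "oabs b"] by blast
qed

lemma convex_subgroup_between:
  assumes "ogroup G" "convex_subgroup G H" "convex_subgroup G C" "H \<subseteq> C"
  shows "convex_subgroup C H"
proof (rule convex_subgroupI)
  show "ogroup C" "ogroup H" "H \<subseteq> C"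
    using assms convex_subgroupD by blast+
  fix a c assume "a \<in> H" "c \<in> C" "0 \<le> c" "c \<le> a"
  moreover from this have "oabs c \<le> oabs a" "c \<in> G"
    using convex_subgroupD[OF assms(1,3)] by auto
  ultimately show "c \<in> H"
    using convex_subgroup_oabs[OF assms(1,2)] by blast
qed

section \<open>The convex subgroups that determine an archimedean component\<close>

text \<open>For \<open>a\<close> in \<open>G\<close> this is the smallest convex subgroup of
  \<open>G\<close> containing \<open>a\<close>.\<close>

definition gen_convex :: "'g::linordered_ab_group_add set \<Rightarrow> 'g \<Rightarrow> 'g set" where
  "gen_convex G a = {c \<in> G. \<exists>n. oabs c \<le> nsmul n (oabs a)}"

lemma convex_gen_convex:
  assumes G: "ogroup G"
  shows "convex_subgroup G (gen_convex G a)"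
proof (rule convex_subgroupI[OF G])
  show "ogroup (gen_convex G a)"
  proof (rule ogroupI)
    show "0 \<in> gen_convex G a"
      using ogroup_zero[OF G] by (simp add: gen_convex_def nsmul_nonneg)
  next
    fix b c assume "b \<in> gen_convex G a" "c \<in> gen_convex G a"
    then obtain m n where mn: "b \<in> G" "c \<in> G" "oabs b \<le> nsmul m (oabs a)" "oabs c \<le> nsmul n (oabs a)"
      by (auto simp: gen_convex_def)
    have "oabs (b - c) \<le> oabs b + oabs c"
      by (rule oabs_diff)
    also have "\<dots> \<le> nsmul (m + n) (oabs a)"
      using mn by (simp add: nsmul_add add_mono)
    finally show "b - c \<in> gen_convex G a"
      using ogroup_diff[OF G mn(1,2)] by (auto simp: gen_convex_def)
  qed
next
  fix b c assume "b \<in> gen_convex G a" "c \<in> G" "0 \<le> c" "c \<le> b"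
  then show "c \<in> gen_convex G a"
    using order_trans[of c b] by (auto simp: gen_convex_def)
qed (auto simp: gen_convex_def)

lemma mem_gen_convex: "a \<in> G \<Longrightarrow> a \<in> gen_convex G a"
  using exI[of "\<lambda>n. oabs a \<le> nsmul n (oabs a)" 1] by (simp add: gen_convex_def)

lemma gen_convex_minimal:
  assumes "ogroup G" "convex_subgroup G C" "a \<in> C"
  shows "gen_convex G a \<subseteq> C"
proof
  fix c assume "c \<in> gen_convex G a"
  then obtain n where n: "c \<in> G" "oabs c \<le> nsmul n (oabs a)"
    by (auto simp: gen_convex_def)
  moreover have "nsmul n (oabs a) \<in> C"
    using assms convex_subgroupD[OF assms(1,2)] ogroup_oabs ogroup_nsmul by blast
  ultimately show "c \<in> C"
    using convex_subgroup_oabs[OF assms(1,2)] by (metis nsmul_nonneg oabs_eq oabs_nonneg)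
qed

text \<open>For nonzero \<open>a\<close> in \<open>G\<close> this is the largest convex subgroup of
  \<open>G\<close> omitting \<open>a\<close>.\<close>

definition infinitesimals :: "'g::linordered_ab_group_add set \<Rightarrow> 'g \<Rightarrow> 'g set" where
  "infinitesimals G a = {c \<in> G. \<forall>n. nsmul n (oabs c) < oabs a}"

lemma convex_infinitesimals:
  assumes G: "ogroup G" and a: "a \<noteq> 0"
  shows "convex_subgroup G (infinitesimals G a)"
proof (rule convex_subgroupI[OF G])
  have nz: "nsmul n 0 = (0::'a)" for n
    by (induction n) auto
  show "ogroup (infinitesimals G a)"
  proof (rule ogroupI)
    show "0 \<in> infinitesimals G a"
      using ogroup_zero[OF G] oabs_pos[OF a] by (auto simp: infinitesimals_def nz)
  next
    fix b c assume bc: "b \<in> infinitesimals G a" "c \<in> infinitesimals G a"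
    have "nsmul n (oabs (b - c)) < oabs a" for n
    proof -
      \<comment> \<open>Both elements are bounded by the larger absolute value \<open>d\<close>, so
        a multiple of the difference is bounded by twice as many copies of \<open>d\<close>, still
        below the absolute value of \<open>a\<close>.\<close>
      define d where "d = max (oabs b) (oabs c)"
      have "oabs (b - c) \<le> oabs b + oabs c"
        by (rule oabs_diff)
      also have "\<dots> \<le> d + d"
        by (auto simp: d_def intro: add_mono)
      finally have "nsmul n (oabs (b - c)) \<le> nsmul (n + n) d"
        using nsmul_mono nsmul_distrib nsmul_add by metis
      also have "\<dots> < oabs a"
        using bc by (auto simp: infinitesimals_def d_def max_def)
      finally show ?thesis .
    qed
    then show "b - c \<in> infinitesimals G a"
      using bc ogroup_diff[OF G] by (auto simp: infinitesimals_def)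
  qed
next
  fix b c assume "b \<in> infinitesimals G a" "c \<in> G" "0 \<le> c" "c \<le> b"
  then show "c \<in> infinitesimals G a"
    using nsmul_mono[of c b] by (auto simp: infinitesimals_def intro: le_less_trans)
qed (auto simp: infinitesimals_def)

lemma not_mem_infinitesimals: "a \<notin> infinitesimals G a"
  using spec[of "\<lambda>n. nsmul n (oabs a) < oabs a" 1] by (auto simp: infinitesimals_def)

text \<open>If some multiple of an element of \<open>C\<close> reached \<open>a\<close> in absolute
  value, convexity would put \<open>a\<close> into \<open>C\<close>.\<close>

lemma infinitesimals_maximal:
  assumes "ogroup G" "convex_subgroup G C" "a \<in> G" "a \<notin> C"
  shows "C \<subseteq> infinitesimals G a"
proof
  fix c assume c: "c \<in> C"
  have "nsmul n (oabs c) < oabs a" for n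
  proof (rule ccontr)
    assume "\<not> ?thesis"
    then have "oabs a \<le> oabs (nsmul n (oabs c))"
      by (simp add: nsmul_nonneg)
    moreover have "nsmul n (oabs c) \<in> C"
      using c assms convex_subgroupD[OF assms(1,2)] ogroup_oabs ogroup_nsmul by blast
    ultimately show False
      using assms convex_subgroup_oabs by blast
  qed
  then show "c \<in> infinitesimals G a"
    using c convex_subgroupD[OF assms(1,2)] by (auto simp: infinitesimals_def)
qed

lemma archimedean_component_eq:
  assumes "ogroup G" "a \<in> G" "a \<noteq> 0"
  shows "archimedean_component G a = oag (gen_convex G a) Mod infinitesimals G a"
proof -
  have "(LEAST C. convex_subgroup G C \<and> a \<in> C) = gen_convex G a"
    using convex_gen_convex[OF assms(1)] mem_gen_convex[OF assms(2)] gen_convex_minimal[OF assms(1)]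
    by (intro Least_equality) blast+
  moreover have "(GREATEST C. convex_subgroup G C \<and> a \<notin> C) = infinitesimals G a"
    using convex_infinitesimals[OF assms(1,3)] not_mem_infinitesimals
      infinitesimals_maximal[OF assms(1) _ assms(2)]
    by (intro Greatest_equality) blast+
  ultimately show ?thesis
    by (simp add: archimedean_component_def)
qed


section \<open>Quotients by convex subgroups\<close>

lemma normal_oag: "ogroup G \<Longrightarrow> subgroup H (oag G) \<Longrightarrow> H \<lhd> oag G"
  using comm_group.subgroup_imp_normal[OF comm_group_oag] by blast

lemma coset_eq_iff:
  assumes "ogroup C" "subgroup H (oag C)" "a \<in> C" "b \<in> C"
  shows "H #>\<^bsub>oag C\<^esub> a = H #>\<^bsub>oag C\<^esub> b \<longleftrightarrow> a - b \<in> H"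
proof -
  have H: "ogroup H" "H \<subseteq> C"
    using assms subgroup_oag_iff by auto
  show ?thesis
  proof
    assume "H #>\<^bsub>oag C\<^esub> a = H #>\<^bsub>oag C\<^esub> b"
    moreover have "a \<in> H #>\<^bsub>oag C\<^esub> a"
      using ogroup_zero[OF H(1)] by (force simp: r_coset_def)
    ultimately show "a - b \<in> H"
      by (auto simp: r_coset_def)
  next
    assume ab: "a - b \<in> H"
    then have "b - a \<in> H"
      using ogroup_diff_swap[OF H(1)] by blast
    then have "\<exists>k\<in>H. h + a = k + b" "\<exists>k\<in>H. h + b = k + a" if "h \<in> H" for h
      using bexI[of "\<lambda>k. h + a = k + b" "h + (a - b)"] bexI[of "\<lambda>k. h + b = k + a" "h + (b - a)"]
        ogroup_add[OF H(1) that ab] ogroup_add[OF H(1) that \<open>b - a \<in> H\<close>]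
      by (simp_all add: algebra_simps)
    then show "H #>\<^bsub>oag C\<^esub> a = H #>\<^bsub>oag C\<^esub> b"
      by (auto simp: r_coset_def)
  qed
qed

text \<open>Between distinct cosets the order does not depend on representatives: if
  \<open>h + a \<le> k + b\<close> but \<open>b \<le> a\<close>, then \<open>a - b\<close> lies
  between 0 and \<open>k - h\<close>, hence in \<open>H\<close>, and the cosets coincide.\<close>

lemma coset_less_iff:
  assumes "ogroup C" "convex_subgroup C H" "a \<in> C" "b \<in> C"
  shows "coset_less (H #>\<^bsub>oag C\<^esub> a) (H #>\<^bsub>oag C\<^esub> b) \<longleftrightarrow> b - a \<notin> H \<and> a < b"
proof -
  have H: "ogroup H" "H \<subseteq> C" "subgroup H (oag C)"
    using convex_subgroupD[OF assms(1,2)] by blast+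
  have "a < b" if "b - a \<notin> H" "h \<in> H" "k \<in> H" "h + a \<le> k + b" for h k
  proof (rule ccontr)
    assume "\<not> a < b"
    moreover have "a - b \<le> k - h"
      using that(4) by (simp add: algebra_simps)
    moreover have "k - h \<in> H"
      using H that ogroup_diff by blast
    ultimately have "a - b \<in> H"
      using convex_subgroup_oabs[OF assms(1,2), of "k - h" "a - b"] ogroup_diff[OF assms(1)] assms(3,4)
      by (metis diff_ge_0_iff_ge le_oabs(1) not_le oabs_eq order_trans)
    then show False
      using that(1) ogroup_diff_swap[OF H(1)] by blast
  qed
  moreover have "0 + a \<in> H #>\<^bsub>oag C\<^esub> a" "0 + b \<in> H #>\<^bsub>oag C\<^esub> b"
    using ogroup_zero[OF H(1)] unfolding r_coset_def by auto
  ultimately show ?thesis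
    unfolding coset_less_def coset_eq_iff[OF assms(1) H(3) assms(3,4)] ogroup_diff_swap[OF H(1), of a b]
    using ogroup_zero[OF H(1)] by (auto simp: r_coset_def intro!: bexI[of _ 0])
qed

lemma carrier_quotient: "carrier (oag C Mod H) = (\<lambda>a. H #>\<^bsub>oag C\<^esub> a) ` C"
  by (auto simp: carrier_FactGroup)

lemma coset_zero: "ogroup C \<Longrightarrow> subgroup H (oag C) \<Longrightarrow> H #>\<^bsub>oag C\<^esub> 0 = H"
  by (simp add: r_coset_def)

text \<open>After translation it suffices to find a coset strictly between 0 and a positive one,
  that is, to split \<open>d\<close> into two positive parts neither of which lies in
  \<open>H\<close>.\<close>

lemma dense_quotient_iff:
  assumes C: "ogroup C" and H: "convex_subgroup C H"
  shows "dense_ordered (oag C Mod H) coset_less \<longleftrightarrow> H \<noteq> C \<and>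
    (\<forall>d\<in>C. 0 < d \<and> d \<notin> H \<longrightarrow> (\<exists>c\<in>C. 0 < c \<and> c \<notin> H \<and> c < d \<and> d - c \<notin> H))"
    (is "_ \<longleftrightarrow> _ \<and> ?split")
proof -
  have sub: "subgroup H (oag C)" "ogroup H" "H \<subseteq> C"
    using convex_subgroupD[OF assms(1,2)] by blast+
  have "carrier (oag C Mod H) = {H} \<longleftrightarrow> H = C"
  proof -
    have "carrier (oag C Mod H) = {H} \<longleftrightarrow> (\<forall>a\<in>C. H #>\<^bsub>oag C\<^esub> a = H)"
      unfolding carrier_quotient using ogroup_zero[OF C] by auto
    also have "\<dots> \<longleftrightarrow> (\<forall>a\<in>C. a \<in> H)"
      using coset_eq_iff[OF C sub(1) _ ogroup_zero[OF C]] coset_zero[OF C sub(1)] by simp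
    finally show ?thesis
      using sub by blast
  qed
  moreover have "(\<forall>a\<in>C. \<forall>b\<in>C. b - a \<notin> H \<and> a < b \<longrightarrow>
      (\<exists>c\<in>C. (c - a \<notin> H \<and> a < c) \<and> b - c \<notin> H \<and> c < b)) \<longleftrightarrow> ?split" (is "?D \<longleftrightarrow> _")
  proof
    assume D: ?D
    show ?split
      using D[rule_format, OF ogroup_zero[OF C]] by auto
  next
    assume s: ?split
    show ?D
    proof (intro ballI impI)
      fix a b assume ab: "a \<in> C" "b \<in> C" "b - a \<notin> H \<and> a < b"
      then obtain c where "c \<in> C" "0 < c" "c \<notin> H" "c < b - a" "b - a - c \<notin> H"
        using s ogroup_diff[OF C] by (metis diff_gt_0_iff_gt)
      then show "\<exists>c\<in>C. (c - a \<notin> H \<and> a < c) \<and> b - c \<notin> H \<and> c < b"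
        using ab ogroup_add[OF C] by (intro bexI[of _ "a + c"]) (auto simp: algebra_simps)
    qed
  qed
  ultimately show ?thesis
    unfolding dense_ordered_def carrier_quotient
    by (simp add: coset_less_iff[OF C H] cong: ball_cong bex_cong)
qed

lemma discrete_quotient_iff:
  assumes C: "ogroup C" and H: "convex_subgroup C H"
  shows "discrete_ordered (oag C Mod H) coset_less \<longleftrightarrow>
    (\<exists>e\<in>C. 0 < e \<and> e \<notin> H \<and> (\<forall>a\<in>C. 0 < a \<and> a \<notin> H \<longrightarrow> e - a \<in> H \<or> e < a))"
proof -
  have sub: "subgroup H (oag C)" "ogroup H" "H \<subseteq> C"
    using convex_subgroupD[OF assms(1,2)] by blast+
  have pos: "coset_less H (H #>\<^bsub>oag C\<^esub> a) \<longleftrightarrow> a \<notin> H \<and> 0 < a" if "a \<in> C" for a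
    using coset_less_iff[OF C H ogroup_zero[OF C] that] coset_zero[OF C sub(1)] by simp
  show ?thesis
    unfolding discrete_ordered_def carrier_quotient
    using ogroup_diff_swap[OF sub(2)]
    by (auto simp: pos coset_less_iff[OF C H] coset_eq_iff[OF C sub(1)]) 
qed

text \<open>Each induction step splits \<open>d\<close> into \<open>c\<close> and
  \<open>d - c\<close>: if \<open>n\<close> copies of \<open>b\<close> fit below \<open>c\<close>,
  then \<open>Suc n\<close> copies of the minimum of \<open>b\<close> and \<open>d - c\<close> fit
  below \<open>d\<close>.\<close>

lemma dense_quotient_divide:
  assumes C: "ogroup C" and H: "convex_subgroup C H"
    and dense: "dense_ordered (oag C Mod H) coset_less"
  shows "d \<in> C \<Longrightarrow> 0 < d \<Longrightarrow> d \<notin> H \<Longrightarrow> \<exists>c\<in>C. 0 < c \<and> c \<notin> H \<and> nsmul n c \<le> d"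
proof (induction n arbitrary: d)
  case 0
  then show ?case by force
next
  case (Suc n)
  obtain c where c: "c \<in> C" "0 < c" "c \<notin> H" "c < d" "d - c \<notin> H"
    using dense Suc.prems unfolding dense_quotient_iff[OF C H] by blast
  obtain b where b: "b \<in> C" "0 < b" "b \<notin> H" "nsmul n b \<le> c"
    using Suc.IH[OF c(1-3)] by blast
  have "nsmul (Suc n) (min b (d - c)) \<le> (d - c) + c"
    unfolding nsmul.simps
    by (intro add_mono order_trans[OF nsmul_mono[of "min b (d - c)" b n] b(4)]) simp_all
  moreover have "min b (d - c) \<in> C"
    using b c Suc.prems ogroup_diff[OF C] by (auto simp: min_def)
  ultimately show ?case
    using b c by (intro bexI[of _ "min b (d - c)"]) (auto simp: min_def)
qed

text \<open>Here \<open>e\<close> represents the least positive coset of \<open>H\<close>. As long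
  as \<open>a\<close> is congruent to neither 0 nor \<open>e\<close>, it exceeds \<open>e\<close>,
  and subtracting \<open>e\<close> lowers the bound \<open>n\<close> by one.\<close>

lemma least_positive_multiples:
  assumes C: "ogroup C" and H: "convex_subgroup C H" and e: "e \<in> C"
    and least: "\<And>a. a \<in> C \<Longrightarrow> 0 < a \<Longrightarrow> a \<notin> H \<Longrightarrow> e - a \<in> H \<or> e < a"
  shows "a \<in> C \<Longrightarrow> 0 \<le> a \<Longrightarrow> a \<le> nsmul n e \<Longrightarrow> \<exists>m\<le>n. a - nsmul m e \<in> H"
proof (induction n arbitrary: a)
  case 0
  then show ?case
    using ogroup_zero[of H] convex_subgroupD[OF C H] by force
next
  case (Suc n)
  note H' = convex_subgroupD(2)[OF C H]
  show ?case
  proof (cases "a \<in> H \<or> e - a \<in> H")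
    case True
    then show ?thesis
      using ogroup_diff_swap[OF H'] by (metis Suc_le_mono diff_zero le0 nsmul.simps(1) nsmul_one One_nat_def)
  next
    case False
    then have "e < a"
      using Suc.prems least[of a] ogroup_zero[OF H'] by (metis order_le_less)
    moreover have "a - e \<le> nsmul n e"
      using Suc.prems(3) by (simp add: algebra_simps)
    ultimately obtain m where "m \<le> n" "a - e - nsmul m e \<in> H"
      using Suc.IH[of "a - e"] less_imp_le[OF \<open>e < a\<close>] ogroup_diff[OF C Suc.prems(1) e] by auto
    then show ?thesis
      by (intro exI[of _ "Suc m"]) (auto simp: algebra_simps)
  qed
qed

lemma nsmul_not_mem_convex:
  assumes "ogroup C" "convex_subgroup C H" "e \<in> C" "e \<notin> H" "0 < n"
  shows "nsmul n e \<notin> H"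
proof
  assume h: "nsmul n e \<in> H"
  have "oabs (nsmul n e) = nsmul n (oabs e)"
    using oabs_minus[of "nsmul n e"] nsmul_nonneg[of "- e" n]
    by (cases "0 \<le> e") (simp_all add: oabs_def nsmul_nonneg nsmul_minus)
  then have "oabs e \<le> oabs (nsmul n e)"
    using assms(5) by (simp add: le_nsmul)
  then show False
    using convex_subgroup_oabs[OF assms(1,2) h assms(3)] assms(4) by blast
qed

text \<open>The powers of the coset of \<open>e\<close> are distinct because no positive multiple of
  \<open>e\<close> lies in \<open>H\<close>, and they exhaust the quotient because every element is
  bounded by a multiple of \<open>e\<close>.\<close>

lemma quotient_iso_integer_group:
  assumes C: "ogroup C" and H: "convex_subgroup C H" and e: "e \<in> C" "e \<notin> H" "0 < e"
    and least: "\<And>a. a \<in> C \<Longrightarrow> 0 < a \<Longrightarrow> a \<notin> H \<Longrightarrow> e - a \<in> H \<or> e < a"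
    and arch: "C \<subseteq> gen_convex C e"
  shows "oag C Mod H \<cong> integer_group"
proof -
  let ?Q = "oag C Mod H" and ?g = "H #>\<^bsub>oag C\<^esub> e"
  have sub: "subgroup H (oag C)" "ogroup H" "H \<subseteq> C"
    using convex_subgroupD[OF C H] by blast+
  interpret N: normal H "oag C"
    using normal_oag[OF C sub(1)] .
  interpret Q: group ?Q
    by (rule N.factorgroup_is_group)
  have g: "?g \<in> carrier ?Q"
    using e by (simp add: carrier_quotient)
  have pow: "?g [^]\<^bsub>?Q\<^esub> n = H #>\<^bsub>oag C\<^esub> nsmul n e" for n :: nat
    using N.FactGroup_pow[of e n] e by (simp add: pow_oag)
  \<comment> \<open>Order 0 encodes infinite order.\<close>
  have "Q.ord ?g = 0"
  proof -
    have "?g [^]\<^bsub>?Q\<^esub> n \<noteq> \<one>\<^bsub>?Q\<^esub>" if "n \<noteq> 0" for n :: nat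
      using coset_eq_iff[OF C sub(1) ogroup_nsmul[OF C e(1), of n] ogroup_zero[OF C]]
        nsmul_not_mem_convex[OF C H e(1,2)] that coset_zero[OF C sub(1)] by (simp add: pow)
    then show ?thesis
      using Q.ord_eq_0[OF g] by blast
  qed
  then have "inj (\<lambda>i::int. ?g [^]\<^bsub>?Q\<^esub> i)"
    using Q.int_pow_eq[OF g] by (auto simp: inj_def)
  moreover have "range (\<lambda>i::int. ?g [^]\<^bsub>?Q\<^esub> i) = carrier ?Q"
  proof
    show "range (\<lambda>i::int. ?g [^]\<^bsub>?Q\<^esub> i) \<subseteq> carrier ?Q"
      using Q.int_pow_closed[OF g] by auto
  next
    have nonneg: "\<exists>n::nat. H #>\<^bsub>oag C\<^esub> a = ?g [^]\<^bsub>?Q\<^esub> n" if a: "a \<in> C" "0 \<le> a" for a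
    proof -
      obtain n where "a \<le> nsmul n e"
        using arch a e by (auto simp: gen_convex_def subset_iff)
      then obtain m where "a - nsmul m e \<in> H"
        using least_positive_multiples[OF C H e(1) least a] by blast
      then show ?thesis
        using coset_eq_iff[OF C sub(1) a(1) ogroup_nsmul[OF C e(1), of m]] by (auto simp: pow)
    qed
    have "\<exists>i::int. H #>\<^bsub>oag C\<^esub> a = ?g [^]\<^bsub>?Q\<^esub> i" if a: "a \<in> C" for a
    proof (cases "0 \<le> a")
      case True
      then show ?thesis
        using nonneg[OF a] by (metis int_pow_int)
    next
      case False
      then obtain n :: nat where n: "H #>\<^bsub>oag C\<^esub> (- a) = ?g [^]\<^bsub>?Q\<^esub> n"
        using nonneg[of "- a"] ogroup_minus[OF C a] by (auto simp: not_le dest: less_imp_le)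
      have "H #>\<^bsub>oag C\<^esub> (- a) = inv\<^bsub>?Q\<^esub> (H #>\<^bsub>oag C\<^esub> a)"
        using N.rcos_inv[of a] N.inv_FactGroup[of "H #>\<^bsub>oag C\<^esub> a"] a inv_oag[OF C a]
        by (simp add: carrier_quotient)
      then have "H #>\<^bsub>oag C\<^esub> a = inv\<^bsub>?Q\<^esub> (?g [^]\<^bsub>?Q\<^esub> n)"
        using n Q.inv_inv[of "H #>\<^bsub>oag C\<^esub> a"] a by (simp add: carrier_quotient)
      then show ?thesis
        using Q.int_pow_neg_int[OF g, of n] by metis
    qed
    then show "carrier ?Q \<subseteq> range (\<lambda>i::int. ?g [^]\<^bsub>?Q\<^esub> i)"
      unfolding carrier_quotient by blast
  qed
  ultimately have "(\<lambda>i::int. ?g [^]\<^bsub>?Q\<^esub> i) \<in> iso integer_group ?Q"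
    using Q.hom_integer_group_pow[OF g] by (auto simp: iso_def bij_betw_def)
  then show ?thesis
    using group.iso_sym[OF group_integer_group] is_isoI by blast
qed

text \<open>A nonzero ordered group that is not dense has a least positive element; being
  archimedean as well, the component would then be infinite cyclic.\<close>

lemma archimedean_components_denseI:
  assumes G: "ogroup G"
    and "\<And>H C. convex_subgroup G H \<Longrightarrow> convex_subgroup G C \<Longrightarrow> H \<subset> C \<Longrightarrow>
      \<not> oag C Mod H \<cong> integer_group"
  shows "archimedean_components_dense G"
  unfolding archimedean_components_dense_def
proof (intro ballI impI)
  fix a assume a: "a \<in> G" "a \<noteq> 0"
  let ?C = "gen_convex G a" and ?H = "infinitesimals G a"
  have conv: "convex_subgroup G ?C" "convex_subgroup G ?H"
    using convex_gen_convex[OF G] convex_infinitesimals[OF G a(2)] by auto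
  have "?H \<subseteq> ?C" "?H \<noteq> ?C"
    using convex_subgroup_chain[OF G conv] mem_gen_convex[OF a(1)] not_mem_infinitesimals[of a G]
    by auto
  then have not_int: "\<not> oag ?C Mod ?H \<cong> integer_group"
    using assms(2)[OF conv(2,1)] by blast
  note C = convex_subgroupD(2)[OF G conv(1)]
  have HC: "convex_subgroup ?C ?H"
    using convex_subgroup_between[OF G conv(2,1) \<open>?H \<subseteq> ?C\<close>] .
  show "dense_ordered (archimedean_component G a) coset_less"
    unfolding archimedean_component_eq[OF G a]
  proof (rule ccontr)
    assume "\<not> dense_ordered (oag ?C Mod ?H) coset_less"
    then obtain e where e: "e \<in> ?C" "0 < e" "e \<notin> ?H"
      and no: "\<And>c. c \<in> ?C \<Longrightarrow> 0 < c \<Longrightarrow> c \<notin> ?H \<Longrightarrow> c < e \<Longrightarrow> e - c \<in> ?H"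
      unfolding dense_quotient_iff[OF C HC] using \<open>?H \<noteq> ?C\<close> by blast
    have eG: "e \<in> G"
      using e convex_subgroupD[OF G conv(1)] by blast
    \<comment> \<open>Every convex subgroup omitting \<open>a\<close> lies inside the
      infinitesimals, which do not contain \<open>e\<close>; so any convex subgroup containing
      \<open>e\<close> contains \<open>a\<close>.\<close>
    have "a \<in> gen_convex G e"
      using infinitesimals_maximal[OF G convex_gen_convex[OF G] a(1)] mem_gen_convex[OF eG] e(3) by blast
    then have "?C \<subseteq> gen_convex G e"
      using gen_convex_minimal[OF G convex_gen_convex[OF G]] by blast
    then have "?C \<subseteq> gen_convex ?C e"
      unfolding gen_convex_def[of ?C] by (auto simp: gen_convex_def[of G e])
    moreover have "e - c \<in> ?H \<or> e < c" if "c \<in> ?C" "0 < c" "c \<notin> ?H" for c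
      using no[OF that] ogroup_zero[OF convex_subgroupD(2)[OF G conv(2)]]
      by (cases c e rule: linorder_cases) auto
    ultimately show False
      using quotient_iso_integer_group[OF C HC e(1,3,2)] not_int by blast
  qed
qed

section \<open>Extensions of ordered groups of prime index\<close>

text \<open>When \<Delta> is a subgroup of \<Gamma>, this is the largest convex subgroup of \<Gamma>
  inside \<Delta>. The elementwise form makes it available before any greatest element is known to
  exist; \<open>greatest_convex_core\<close> makes the link with \<open>H_core\<close>.\<close>

definition convex_core :: "'g::linordered_ab_group_add set \<Rightarrow> 'g set \<Rightarrow> 'g set" where
  "convex_core \<Gamma> \<Delta> = {c \<in> \<Gamma>. gen_convex \<Gamma> c \<subseteq> \<Delta>}"

locale prime_index =
  fixes \<Gamma> \<Delta> :: "'g::linordered_ab_group_add set" and q :: nat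
  assumes \<Gamma>: "ogroup \<Gamma>" and \<Delta>: "ogroup \<Delta>" and sub: "\<Delta> \<subseteq> \<Gamma>"
    and q: "Factorial_Ring.prime q" and index: "card (rcosets\<^bsub>oag \<Gamma>\<^esub> \<Delta>) = q"
begin

section \<open>The quotient of prime order\<close>

lemma subgroup_oag: "subgroup \<Delta> (oag \<Gamma>)"
  using \<Gamma> \<Delta> sub subgroup_oag_iff by blast

sublocale N: normal \<Delta> "oag \<Gamma>"
  by (rule normal_oag[OF \<Gamma> subgroup_oag])

sublocale Q: group "oag \<Gamma> Mod \<Delta>"
  by (rule N.factorgroup_is_group)

lemma order_quotient: "order (oag \<Gamma> Mod \<Delta>) = q"
  using index by (simp add: order_def FactGroup_def)

lemma coset_pow:
  assumes "\<beta> \<in> \<Gamma>"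
  shows "(\<Delta> #>\<^bsub>oag \<Gamma>\<^esub> \<beta>) [^]\<^bsub>oag \<Gamma> Mod \<Delta>\<^esub> (n::nat) = \<Delta> #>\<^bsub>oag \<Gamma>\<^esub> nsmul n \<beta>"
  using N.FactGroup_pow[of \<beta> n] assms by (simp add: pow_oag)

lemma coset_pow_eq_one:
  assumes "\<beta> \<in> \<Gamma>"
  shows "(\<Delta> #>\<^bsub>oag \<Gamma>\<^esub> \<beta>) [^]\<^bsub>oag \<Gamma> Mod \<Delta>\<^esub> (n::nat) = \<one>\<^bsub>oag \<Gamma> Mod \<Delta>\<^esub> \<longleftrightarrow> nsmul n \<beta> \<in> \<Delta>"
  using coset_eq_iff[OF \<Gamma> subgroup_oag ogroup_nsmul[OF \<Gamma> assms] ogroup_zero[OF \<Gamma>]]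
  by (simp add: coset_pow[OF assms] coset_zero[OF \<Gamma> subgroup_oag])

text \<open>The order divides the prime \<open>q\<close> by Lagrange and is not 1.\<close>

lemma ord_coset:
  assumes "\<beta> \<in> \<Gamma>" "\<beta> \<notin> \<Delta>"
  shows "Q.ord (\<Delta> #>\<^bsub>oag \<Gamma>\<^esub> \<beta>) = q"
proof -
  have c: "\<Delta> #>\<^bsub>oag \<Gamma>\<^esub> \<beta> \<in> carrier (oag \<Gamma> Mod \<Delta>)"
    using assms by (simp add: carrier_quotient)
  have "Q.ord (\<Delta> #>\<^bsub>oag \<Gamma>\<^esub> \<beta>) dvd q"
    using Q.ord_dvd_group_order[OF c] by (simp add: order_quotient)
  moreover have "\<not> Q.ord (\<Delta> #>\<^bsub>oag \<Gamma>\<^esub> \<beta>) dvd 1"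
    using Q.pow_eq_id[OF c, of 1] coset_pow_eq_one[OF assms(1), of 1] assms(2) by simp
  ultimately show ?thesis
    using q prime_nat_iff by auto
qed

lemma nsmul_mem_iff:
  assumes "\<beta> \<in> \<Gamma>" "\<beta> \<notin> \<Delta>"
  shows "nsmul n \<beta> \<in> \<Delta> \<longleftrightarrow> q dvd n"
  using Q.pow_eq_id[of "\<Delta> #>\<^bsub>oag \<Gamma>\<^esub> \<beta>" n] coset_pow_eq_one[OF assms(1), of n] ord_coset[OF assms] assms
  by (simp add: carrier_quotient)

lemma nsmul_index_mem: "\<beta> \<in> \<Gamma> \<Longrightarrow> nsmul q \<beta> \<in> \<Delta>"
  using nsmul_mem_iff[of \<beta> q] ogroup_nsmul[OF \<Delta>, of \<beta> q] by auto

text \<open>A nontrivial coset generates the quotient of prime order: its first \<open>q\<close>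
  powers are distinct and therefore fill a set of \<open>q\<close> elements.\<close>

lemma multiple_in_coset:
  assumes "\<beta> \<in> \<Gamma>" "\<beta> \<notin> \<Delta>" "\<alpha> \<in> \<Gamma>"
  obtains j where "j < q" "\<alpha> - nsmul j \<beta> \<in> \<Delta>"
proof -
  let ?g = "\<Delta> #>\<^bsub>oag \<Gamma>\<^esub> \<beta>"
  let ?p = "\<lambda>n::nat. ?g [^]\<^bsub>oag \<Gamma> Mod \<Delta>\<^esub> n"
  have g: "?g \<in> carrier (oag \<Gamma> Mod \<Delta>)"
    using assms by (simp add: carrier_quotient)
  have q0: "0 < q"
    using q prime_gt_0_nat by blast
  have "{0 .. q - 1} = {..<q}"
    using q0 by auto
  then have "inj_on ?p {..<q}"
    using Q.ord_inj[OF g] ord_coset[OF assms(1,2)] by simp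
  then have "card (?p ` {..<q}) = card (carrier (oag \<Gamma> Mod \<Delta>))"
    using order_quotient by (simp add: card_image order_def)
  moreover have "?p ` {..<q} \<subseteq> carrier (oag \<Gamma> Mod \<Delta>)"
    using g by auto
  moreover have "finite (carrier (oag \<Gamma> Mod \<Delta>))"
    using order_quotient q0 Q.order_gt_0_iff_finite by simp
  ultimately have "?p ` {..<q} = carrier (oag \<Gamma> Mod \<Delta>)"
    using card_subset_eq by blast
  moreover have "\<Delta> #>\<^bsub>oag \<Gamma>\<^esub> \<alpha> \<in> carrier (oag \<Gamma> Mod \<Delta>)"
    using assms by (simp add: carrier_quotient)
  ultimately obtain j where "j < q" "\<Delta> #>\<^bsub>oag \<Gamma>\<^esub> \<alpha> = ?p j"
    by blast
  then show ?thesis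
    using that coset_eq_iff[OF \<Gamma> subgroup_oag assms(3) ogroup_nsmul[OF \<Gamma> assms(1)]]
    by (simp add: coset_pow[OF assms(1)])
qed

section \<open>The core, and the cosets met by convex subgroups above it\<close>

abbreviation "H \<equiv> convex_core \<Gamma> \<Delta>"

lemma core_subset: "H \<subseteq> \<Delta>"
  using mem_gen_convex by (auto simp: convex_core_def)

lemma core_maximal: "convex_subgroup \<Gamma> D \<Longrightarrow> D \<subseteq> \<Delta> \<Longrightarrow> D \<subseteq> H"
  using gen_convex_minimal[OF \<Gamma>] convex_subgroupD(1)[OF \<Gamma>] unfolding convex_core_def by blast

lemma convex_core: "convex_subgroup \<Gamma> H"
proof (rule convex_subgroupI[OF \<Gamma>])
  show "ogroup H"
  proof (rule ogroupI)
    have "gen_convex \<Gamma> 0 \<subseteq> {0}"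
      by (rule gen_convex_minimal[OF \<Gamma>])
        (auto intro!: convex_subgroupI \<Gamma> ogroupI ogroup_zero[OF \<Gamma>])
    then show "0 \<in> H"
      using ogroup_zero[OF \<Gamma>] ogroup_zero[OF \<Delta>] by (auto simp: convex_core_def)
  next
    fix a b assume ab: "a \<in> H" "b \<in> H"
    then have G: "a \<in> \<Gamma>" "b \<in> \<Gamma>"
      by (auto simp: convex_core_def)
    note conv = convex_gen_convex[OF \<Gamma>]
    \<comment> \<open>The two generated convex subgroups are comparable; the larger one contains
      both elements and still lies in \<Delta>.\<close>
    obtain c where "c \<in> {a, b}" "gen_convex \<Gamma> a \<subseteq> gen_convex \<Gamma> c" "gen_convex \<Gamma> b \<subseteq> gen_convex \<Gamma> c"
      using convex_subgroup_chain[OF \<Gamma> conv conv, of a b] by blast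
    moreover from this have "a \<in> gen_convex \<Gamma> c" "b \<in> gen_convex \<Gamma> c"
      using mem_gen_convex G by blast+
    ultimately have "a - b \<in> gen_convex \<Gamma> c" "gen_convex \<Gamma> c \<subseteq> \<Delta>"
      using ab ogroup_diff[OF convex_subgroupD(2)[OF \<Gamma> conv]] by (auto simp: convex_core_def)
    then show "a - b \<in> H"
      using gen_convex_minimal[OF \<Gamma> conv, of "a - b" c] ogroup_diff[OF \<Gamma> G]
      by (auto simp: convex_core_def)
  qed
next
  fix a c assume "a \<in> H" "c \<in> \<Gamma>" "0 \<le> c" "c \<le> a"
  moreover from this have "c \<in> gen_convex \<Gamma> a"
    using convex_subgroup_oabs[OF \<Gamma> convex_gen_convex[OF \<Gamma>] mem_gen_convex, of a c]
    by (auto simp: convex_core_def)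
  ultimately show "c \<in> H"
    using gen_convex_minimal[OF \<Gamma> convex_gen_convex[OF \<Gamma>], of c a] by (auto simp: convex_core_def)
qed (auto simp: convex_core_def)

lemmas core_ogroup = convex_subgroupD(2)[OF \<Gamma> convex_core]

text \<open>A convex subgroup of \<Gamma> lying in \<Delta> is automatically convex in \<Delta>, so
  convexity in both groups amounts to convexity in \<Gamma> together with inclusion in
  \<Delta>.\<close>

lemma greatest_convex_core:
  "(GREATEST D. convex_subgroup \<Gamma> D \<and> convex_subgroup \<Delta> D) = H"
proof (rule Greatest_equality)
  have "convex_subgroup \<Delta> H"
  proof (rule convex_subgroupI[OF \<Delta> core_subset core_ogroup])
    fix a c assume "a \<in> H" "c \<in> \<Delta>" "0 \<le> c" "c \<le> a"
    then show "c \<in> H"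
      using convex_subgroup_oabs[OF \<Gamma> convex_core, of a c] sub by auto
  qed
  then show "convex_subgroup \<Gamma> H \<and> convex_subgroup \<Delta> H"
    using convex_core by blast
next
  fix D assume "convex_subgroup \<Gamma> D \<and> convex_subgroup \<Delta> D"
  then show "D \<le> H"
    using core_maximal convex_subgroupD(1)[OF \<Delta>] by blast
qed

lemma not_mem_core: "\<alpha> \<notin> \<Delta> \<Longrightarrow> \<alpha> \<notin> H"
  using core_subset by blast

text \<open>Multiples of an element of \<open>D\<close> outside \<Delta> meet every coset of
  \<Delta>. A negative representative \<open>c\<close> is replaced by \<open>c - nsmul q c\<close>,
  which is nonnegative and in the same coset since \<open>nsmul q c\<close> lies in
  \<Delta>.\<close>

lemma positive_coset_element:
  assumes "convex_subgroup \<Gamma> D" "\<not> D \<subseteq> \<Delta>" "\<xi> \<in> \<Gamma>"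
  obtains \<beta> where "\<beta> \<in> D" "\<beta> - \<xi> \<in> \<Delta>" "\<beta> \<ge> 0"
proof -
  note D = convex_subgroupD[OF \<Gamma> assms(1)]
  obtain b where b: "b \<in> D" "b \<notin> \<Delta>"
    using assms(2) by blast
  then obtain j where "\<xi> - nsmul j b \<in> \<Delta>"
    using multiple_in_coset[of b \<xi>] assms(3) D by blast
  then have j: "nsmul j b - \<xi> \<in> \<Delta>"
    using ogroup_diff_swap[OF \<Delta>] by blast
  define c where "c = nsmul j b"
  have c: "c \<in> D" "c - \<xi> \<in> \<Delta>"
    using j b(1) ogroup_nsmul[OF D(2)] by (auto simp: c_def)
  show ?thesis
  proof (cases "0 \<le> c")
    case True
    then show ?thesis using c that by blast
  next
    case False
    have "nsmul q c \<in> \<Delta>" "nsmul q c \<in> D"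
      using c(1) D nsmul_index_mem ogroup_nsmul by blast+
    then have "c - nsmul q c \<in> D" "c - nsmul q c - \<xi> \<in> \<Delta>"
      using c ogroup_diff[OF D(2)] ogroup_diff[OF \<Delta> c(2), of "nsmul q c"] by (auto simp: algebra_simps)
    moreover have "- c \<le> nsmul q (- c)"
      using False q prime_ge_1_nat by (intro le_nsmul) auto
    then have "0 \<le> c - nsmul q c"
      by (simp add: nsmul_minus)
    ultimately show ?thesis using that by blast
  qed
qed

text \<open>The counterpart of \<open>is_H_tilde\<close> for an abstract pair of ordered groups;
  \<open>is_H_tilde_eq\<close> identifies the two.\<close>

definition is_tilde :: "'g set \<Rightarrow> bool" where
  "is_tilde C \<longleftrightarrow> convex_subgroup \<Gamma> C \<and> H \<subset> C \<and>
     (\<forall>D. convex_subgroup \<Gamma> D \<and> H \<subset> D \<longrightarrow> C \<subseteq> D)"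

lemma gen_convex_core:
  assumes "\<alpha> \<in> \<Gamma>" "\<alpha> \<notin> H"
  shows "H \<subset> gen_convex \<Gamma> \<alpha>"
  using convex_subgroup_chain[OF \<Gamma> convex_core convex_gen_convex[OF \<Gamma>], of \<alpha>]
    mem_gen_convex[OF assms(1)] assms(2) by blast

text \<open>By minimality no convex subgroup lies strictly between \<open>H\<close> and
  \<open>C\<close>. This is the archimedean property of the quotient, in the form in which it is
  used below.\<close>

lemma tilde_eq_gen_convex:
  assumes "is_tilde C" "\<alpha> \<in> C" "\<alpha> \<notin> H"
  shows "C = gen_convex \<Gamma> \<alpha>"
proof
  have C: "convex_subgroup \<Gamma> C" "\<And>D. convex_subgroup \<Gamma> D \<Longrightarrow> H \<subset> D \<Longrightarrow> C \<subseteq> D"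
    using assms(1) unfolding is_tilde_def by blast+
  then have "\<alpha> \<in> \<Gamma>"
    using assms(2) convex_subgroupD(1)[OF \<Gamma>] by blast
  then show "C \<subseteq> gen_convex \<Gamma> \<alpha>"
    using C(2)[OF convex_gen_convex[OF \<Gamma>] gen_convex_core[OF _ assms(3)]] by blast
  show "gen_convex \<Gamma> \<alpha> \<subseteq> C"
    using gen_convex_minimal[OF \<Gamma> C(1) assms(2)] .
qed

lemma tilde_not_subset: "is_tilde C \<Longrightarrow> \<not> C \<subseteq> \<Delta>"
  using core_maximal unfolding is_tilde_def by blast

lemma less_of_not_mem_convex:
  assumes "convex_subgroup \<Gamma> D" "\<beta> \<in> D" "\<alpha> \<in> \<Gamma>" "\<alpha> \<notin> D" "0 \<le> \<alpha>"
  shows "\<beta> < \<alpha>"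
proof (rule ccontr)
  assume "\<not> ?thesis"
  then have "oabs \<alpha> \<le> oabs \<beta>"
    using assms(5) le_oabs(1)[of \<beta>] by auto
  then show False
    using convex_subgroup_oabs[OF \<Gamma> assms(1-3)] assms(4) by blast
qed

text \<open>The condition on value groups to which the properties (P1), (P2), (P3) reduce.\<close>

definition divisible_below :: "'g \<Rightarrow> bool" where
  "divisible_below \<xi> \<longleftrightarrow> (\<forall>i \<delta>. 1 \<le> i \<and> i < q \<and> \<delta> \<in> \<Delta> \<and> 0 < \<delta> + nsmul i \<xi> \<longrightarrow>
     (\<exists>\<epsilon>\<in>\<Delta>. 0 < \<epsilon> + \<xi> \<and> nsmul i \<epsilon> \<le> \<delta>))"

lemma not_dvd_index: "1 \<le> i \<Longrightarrow> i < q \<Longrightarrow> \<not> q dvd i"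
  using nat_dvd_not_less by auto

lemma coset_not_mem:
  assumes "\<xi> \<in> \<Gamma>" "\<xi> \<notin> \<Delta>" "1 \<le> i" "i < q" "\<delta> \<in> \<Delta>"
  shows "\<delta> + nsmul i \<xi> \<notin> \<Delta>"
  using ogroup_add_cancel[OF \<Delta> assms(5), of "nsmul i \<xi>"] nsmul_mem_iff[OF assms(1,2)]
    not_dvd_index[OF assms(3,4)] by (simp add: add.commute)

text \<open>Put \<open>\<alpha> = \<delta> + nsmul i \<xi>\<close> and
  \<open>\<beta> = \<epsilon> + \<xi>\<close>. Bounding \<open>q\<close> copies of \<beta> takes
  care of all \<open>i < q\<close> at once, and \<beta> cannot vanish because \<xi> is outside
  \<Delta>.\<close>

lemma divisible_belowI:
  assumes \<xi>: "\<xi> \<in> \<Gamma>" "\<xi> \<notin> \<Delta>"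
    and div: "\<And>\<alpha>. \<alpha> \<in> \<Gamma> \<Longrightarrow> 0 < \<alpha> \<Longrightarrow> \<alpha> \<notin> H \<Longrightarrow> \<exists>\<beta>\<ge>0. \<beta> - \<xi> \<in> \<Delta> \<and> nsmul q \<beta> \<le> \<alpha>"
  shows "divisible_below \<xi>"
  unfolding divisible_below_def
proof (intro allI impI, elim conjE)
  fix i \<delta> assume i: "1 \<le> i" "i < q" "\<delta> \<in> \<Delta>" "0 < \<delta> + nsmul i \<xi>"
  have "\<delta> + nsmul i \<xi> \<in> \<Gamma>"
    using i sub \<xi> ogroup_add[OF \<Gamma>] ogroup_nsmul[OF \<Gamma>] by blast
  then obtain \<beta> where \<beta>: "0 \<le> \<beta>" "\<beta> - \<xi> \<in> \<Delta>" "nsmul q \<beta> \<le> \<delta> + nsmul i \<xi>"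
    using div i not_mem_core coset_not_mem[OF \<xi> i(1-3)] by blast
  have "\<beta> \<noteq> 0"
    using \<beta>(2) \<xi>(2) ogroup_minus[OF \<Delta>, of "- \<xi>"] by auto
  moreover have "nsmul i \<beta> \<le> \<delta> + nsmul i \<xi>"
    using nsmul_mono_left[of \<beta> i q] \<beta> i by auto
  then have "nsmul i (\<beta> - \<xi>) \<le> \<delta>"
    by (simp add: nsmul_diff diff_le_eq)
  ultimately show "\<exists>\<epsilon>\<in>\<Delta>. 0 < \<epsilon> + \<xi> \<and> nsmul i \<epsilon> \<le> \<delta>"
    using \<beta> by (intro bexI[of _ "\<beta> - \<xi>"]) auto
qed

text \<open>Any nonnegative \<beta> from \<open>D\<close> in the right coset serves: its multiples
  stay in \<open>D\<close> and hence below \<alpha>.\<close>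

lemma divisible_below_of_smaller_convex:
  assumes "convex_subgroup \<Gamma> D" "H \<subset> D" "\<xi> \<in> \<Gamma>" "\<alpha> \<in> \<Gamma>" "0 < \<alpha>" "\<alpha> \<notin> D"
  shows "\<exists>\<beta>\<ge>0. \<beta> - \<xi> \<in> \<Delta> \<and> nsmul q \<beta> \<le> \<alpha>"
proof -
  have "\<not> D \<subseteq> \<Delta>"
    using core_maximal assms by blast
  then obtain \<beta> where \<beta>: "\<beta> \<in> D" "\<beta> - \<xi> \<in> \<Delta>" "\<beta> \<ge> 0"
    using positive_coset_element[OF assms(1) _ assms(3)] by blast
  then have "nsmul q \<beta> < \<alpha>"
    using less_of_not_mem_convex[OF assms(1) _ assms(4,6)] assms(5)
      ogroup_nsmul[OF convex_subgroupD(2)[OF \<Gamma> assms(1)]] by auto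
  then show ?thesis
    using \<beta> less_imp_le by blast
qed

section \<open>The three types of extensions on the level of value groups\<close>

text \<open>The convex subgroup generated by \<alpha> lies strictly above \<open>H\<close> but is
  not the smallest such, so some convex subgroup above \<open>H\<close> omits \<alpha>.\<close>

lemma divisible_below_DL2a:
  assumes "\<nexists>C. is_tilde C" "\<xi> \<in> \<Gamma>" "\<xi> \<notin> \<Delta>"
  shows "divisible_below \<xi>"
proof (rule divisible_belowI[OF assms(2,3)])
  fix \<alpha> assume \<alpha>: "\<alpha> \<in> \<Gamma>" "0 < \<alpha>" "\<alpha> \<notin> H"
  have "\<not> is_tilde (gen_convex \<Gamma> \<alpha>)"
    using assms(1) by blast
  then obtain D where D: "convex_subgroup \<Gamma> D" "H \<subset> D" "\<not> gen_convex \<Gamma> \<alpha> \<subseteq> D"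
    using gen_convex_core[OF \<alpha>(1,3)] convex_gen_convex[OF \<Gamma>, of \<alpha>] unfolding is_tilde_def by metis
  then have "\<alpha> \<notin> D"
    using gen_convex_minimal[OF \<Gamma>] by blast
  then show "\<exists>\<beta>\<ge>0. \<beta> - \<xi> \<in> \<Delta> \<and> nsmul q \<beta> \<le> \<alpha>"
    using divisible_below_of_smaller_convex D assms(2) \<alpha> by blast
qed

lemma divisible_below_DL2b:
  assumes C: "is_tilde C" and dense: "dense_ordered (oag C Mod H) coset_less"
    and \<xi>: "\<xi> \<in> \<Gamma>" "\<xi> \<notin> \<Delta>"
  shows "divisible_below \<xi>"
proof (rule divisible_belowI[OF \<xi>])
  fix \<alpha> assume \<alpha>: "\<alpha> \<in> \<Gamma>" "0 < \<alpha>" "\<alpha> \<notin> H"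
  have conv: "convex_subgroup \<Gamma> C" "H \<subset> C"
    using C by (auto simp: is_tilde_def)
  note C' = convex_subgroupD[OF \<Gamma> conv(1)]
  have HC: "convex_subgroup C H"
    using convex_subgroup_between[OF \<Gamma> convex_core conv(1)] conv(2) by blast
  show "\<exists>\<beta>\<ge>0. \<beta> - \<xi> \<in> \<Delta> \<and> nsmul q \<beta> \<le> \<alpha>"
  proof (cases "\<alpha> \<in> C")
    case False
    then show ?thesis
      using divisible_below_of_smaller_convex[OF conv \<xi>(1) \<alpha>(1,2)] by blast
  next
    case True
    \<comment> \<open>One factor \<open>q\<close> brings the modulus
      \<open>\<eta> = nsmul q \<gamma>\<close> into \<Delta>, the other ensures that
      \<open>q\<close> copies of the remainder, at most \<eta>, still fit below \<alpha>.\<close>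
    obtain \<gamma> where \<gamma>: "\<gamma> \<in> C" "0 < \<gamma>" "\<gamma> \<notin> H" "nsmul (q * q) \<gamma> \<le> \<alpha>"
      using dense_quotient_divide[OF C'(2) HC dense True \<alpha>(2,3)] by blast
    define \<eta> where "\<eta> = nsmul q \<gamma>"
    have \<eta>: "\<eta> \<in> C" "\<eta> \<notin> H" "\<eta> \<in> \<Delta>" "0 \<le> \<eta>"
      unfolding \<eta>_def using \<gamma> C' ogroup_nsmul[OF C'(2)] nsmul_index_mem nsmul_nonneg[of \<gamma> q]
        nsmul_not_mem_convex[OF C'(2) HC \<gamma>(1,3)] prime_gt_0_nat[OF q] by auto
    obtain \<beta> where \<beta>: "\<beta> \<in> C" "\<beta> - \<xi> \<in> \<Delta>" "\<beta> \<ge> 0"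
      using positive_coset_element[OF conv(1) tilde_not_subset[OF C] \<xi>(1)] by blast
    have "\<exists>n. \<beta> \<le> nsmul n \<eta>"
      using tilde_eq_gen_convex[OF C \<eta>(1,2)] \<beta> \<eta> by (auto simp: gen_convex_def)
    \<comment> \<open>With \<open>n\<close> minimal, subtracting \<open>n - 1\<close> copies of
      \<eta> leaves a remainder between 0 and \<eta> without changing the coset. Here
      \<open>n\<close> is positive because \<beta> is nonzero.\<close>
    then obtain n where n: "\<beta> \<le> nsmul n \<eta>" "\<And>m. m < n \<Longrightarrow> \<not> \<beta> \<le> nsmul m \<eta>"
      using exists_least_iff[of "\<lambda>n. \<beta> \<le> nsmul n \<eta>"] by blast
    have "n \<noteq> 0"
      using n(1) \<beta> \<xi>(2) ogroup_minus[OF \<Delta>, of "- \<xi>"] by (cases n) auto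
    then obtain m where m: "n = Suc m"
      using not0_implies_Suc by blast
    have "0 \<le> \<beta> - nsmul m \<eta>" "\<beta> - nsmul m \<eta> \<le> \<eta>"
      using n(1) n(2)[of m] by (auto simp: m algebra_simps dest: less_imp_le)
    moreover have "\<beta> - nsmul m \<eta> - \<xi> \<in> \<Delta>"
      using ogroup_diff[OF \<Delta> \<beta>(2) ogroup_nsmul[OF \<Delta> \<eta>(3), of m]] by (simp add: algebra_simps)
    moreover have "nsmul q \<eta> \<le> \<alpha>"
      using \<gamma>(4) by (simp add: \<eta>_def nsmul_nsmul)
    ultimately show ?thesis
      using nsmul_mono[of "\<beta> - nsmul m \<eta>" \<eta> q] by (meson order_trans)
  qed
qed

text \<open>The element \<open>e\<close> represents the least positive coset of \<open>H\<close> in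
  \<open>C\<close>, and \<open>j\<close> tells which power of the given generator has value
  congruent to \<open>e\<close> modulo \<Delta>. The element \<open>h\<close> corrects for the fact
  that \<open>e\<close> is least only modulo \<open>H\<close>.\<close>

lemma DL2c_generator:
  assumes C: "is_tilde C" and discr: "discrete_ordered (oag C Mod H) coset_less"
    and \<xi>: "\<xi> \<in> \<Gamma>" "\<xi> \<notin> \<Delta>"
  obtains e j where "e \<in> \<Gamma>" "0 < e" "1 \<le> j" "j < q" "e - nsmul j \<xi> \<in> \<Delta>"
    and "\<And>i \<alpha>. 1 \<le> i \<Longrightarrow> i < q \<Longrightarrow> \<alpha> \<in> \<Gamma> \<Longrightarrow> 0 < \<alpha> \<Longrightarrow> \<alpha> - nsmul i e \<in> \<Delta> \<Longrightarrow>
      \<exists>h\<in>H. h < e \<and> nsmul i (e - h) \<le> \<alpha>"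
proof -
  have conv: "convex_subgroup \<Gamma> C" "H \<subset> C"
    using C by (auto simp: is_tilde_def)
  note C' = convex_subgroupD[OF \<Gamma> conv(1)]
  have HC: "convex_subgroup C H"
    using convex_subgroup_between[OF \<Gamma> convex_core conv(1)] conv(2) by blast
  obtain e where e: "e \<in> C" "0 < e" "e \<notin> H"
    and least: "\<And>a. a \<in> C \<Longrightarrow> 0 < a \<Longrightarrow> a \<notin> H \<Longrightarrow> e - a \<in> H \<or> e < a"
    using discr unfolding discrete_quotient_iff[OF C'(2) HC] by blast
  have e\<Gamma>: "e \<in> \<Gamma>"
    using e C' by blast
  have mult: "\<exists>m. a - nsmul m e \<in> H" if a: "a \<in> C" "0 \<le> a" for a
  proof -
    obtain n where "a \<le> nsmul n e"
      using tilde_eq_gen_convex[OF C e(1,3)] a e(2) by (auto simp: gen_convex_def)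
    then show ?thesis
      using least_positive_multiples[OF C'(2) HC e(1) least a] by blast
  qed
  \<comment> \<open>Modulo \<open>H\<close> every nonnegative element of \<open>C\<close> is a
    multiple of \<open>e\<close>; if \<open>e\<close> were in \<Delta>, all of \<open>C\<close>
    would be.\<close>
  have e\<Delta>: "e \<notin> \<Delta>"
  proof
    assume e': "e \<in> \<Delta>"
    have "c \<in> \<Delta>" if c: "c \<in> C" for c
    proof -
      obtain m where "oabs c - nsmul m e \<in> H"
        using mult[of "oabs c"] c ogroup_oabs[OF C'(2)] by auto
      then have "oabs c - nsmul m e + nsmul m e \<in> \<Delta>"
        using core_subset e' ogroup_add[OF \<Delta>] ogroup_nsmul[OF \<Delta>] by blast
      then show ?thesis
        using ogroup_oabs[OF \<Delta>] by simp
    qed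
    then show False
      using tilde_not_subset[OF C] by blast
  qed
  obtain j where j: "j < q" "e - nsmul j \<xi> \<in> \<Delta>"
    using multiple_in_coset[OF \<xi> e\<Gamma>] by blast
  have "j \<noteq> 0"
    using j(2) e\<Delta> by (cases j) auto
  moreover have "\<exists>h\<in>H. h < e \<and> nsmul i (e - h) \<le> \<alpha>"
    if i: "1 \<le> i" "i < q" and \<alpha>: "\<alpha> \<in> \<Gamma>" "0 < \<alpha>" "\<alpha> - nsmul i e \<in> \<Delta>" for i \<alpha>
  proof (cases "\<alpha> \<in> C")
    case False
    then have "nsmul i e < \<alpha>"
      using less_of_not_mem_convex[OF conv(1)] \<alpha> e(1) ogroup_nsmul[OF C'(2)] less_imp_le by blast
    then show ?thesis
      using e(2) ogroup_zero[OF core_ogroup] by (intro bexI[of _ 0]) auto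
  next
    case True
    obtain m where m: "\<alpha> - nsmul m e \<in> H"
      using mult[OF True] \<alpha>(2) less_imp_le by blast
    \<comment> \<open>Otherwise \<open>nsmul (i - m) e\<close> would lie in \<Delta> although
      \<open>0 < i - m < q\<close>.\<close>
    have "i \<le> m"
    proof (rule ccontr)
      assume "\<not> i \<le> m"
      then have "nsmul i e = nsmul (i - m) e + nsmul m e"
        by (simp flip: nsmul_add)
      moreover have "(\<alpha> - nsmul m e) - (\<alpha> - nsmul i e) \<in> \<Delta>"
        using m \<alpha>(3) core_subset ogroup_diff[OF \<Delta>] by blast
      ultimately have "nsmul (i - m) e \<in> \<Delta>"
        by simp
      then have "q dvd i - m"
        using nsmul_mem_iff[OF e\<Gamma> e\<Delta>] by blast
      then show False
        using not_dvd_index[of "i - m"] \<open>\<not> i \<le> m\<close> i by auto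
    qed
    \<comment> \<open>\<alpha> falls below \<open>nsmul m e\<close> by at most \<open>h\<close>, and
      subtracting \<open>h\<close> from each of the \<open>i \<ge> 1\<close> copies of
      \<open>e\<close> makes up for this.\<close>
    define h where "h = oabs (\<alpha> - nsmul m e)"
    have h: "h \<in> H" "0 \<le> h"
      using m ogroup_oabs[OF core_ogroup] by (auto simp: h_def)
    moreover have "h < e"
      using less_of_not_mem_convex[OF convex_core h(1) e\<Gamma> e(3)] e(2) less_imp_le by blast
    moreover have "nsmul i (e - h) \<le> \<alpha>"
    proof -
      have "nsmul i e - nsmul i h \<le> nsmul m e - h"
        using nsmul_mono_left[OF less_imp_le[OF e(2)] \<open>i \<le> m\<close>] le_nsmul[OF h(2) i(1)]
        by (rule diff_mono)
      also have "\<dots> \<le> \<alpha>"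
        using le_oabs(2)[of "\<alpha> - nsmul m e"] by (simp add: h_def algebra_simps)
      finally show ?thesis
        by (simp add: nsmul_diff)
    qed
    ultimately show ?thesis by blast
  qed
  ultimately show ?thesis
    using that[OF e\<Gamma> e(2) _ j] by auto
qed

text \<open>Multiplication by \<open>q\<close> carries \<Gamma> into \<Delta> and leaves archimedean
  classes unchanged. So \<open>C \<inter> \<Delta>\<close> modulo \<open>H\<close> is an archimedean
  component of \<Delta>, and its density is pulled back along this multiplication.\<close>

lemma dense_tilde_quotient:
  assumes dense: "archimedean_components_dense \<Delta>" and C: "is_tilde C"
  shows "dense_ordered (oag C Mod H) coset_less"
proof -
  have conv: "convex_subgroup \<Gamma> C" "H \<subset> C"
    using C by (auto simp: is_tilde_def)
  note C' = convex_subgroupD[OF \<Gamma> conv(1)]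
  have HC: "convex_subgroup C H"
    using convex_subgroup_between[OF \<Gamma> convex_core conv(1)] conv(2) by blast
  have q0: "0 < q"
    using q prime_gt_0_nat by blast
  obtain c where c: "c \<in> C" "c \<notin> H"
    using conv by blast
  define \<gamma> where "\<gamma> = nsmul q c"
  have \<gamma>: "\<gamma> \<in> C" "\<gamma> \<notin> H" "\<gamma> \<in> \<Delta>" "\<gamma> \<in> \<Gamma>"
    unfolding \<gamma>_def using c C' ogroup_nsmul[OF C'(2)] nsmul_index_mem
      nsmul_not_mem_convex[OF C'(2) HC c q0] by auto
  have \<gamma>0: "\<gamma> \<noteq> 0"
    using \<gamma>(2) ogroup_zero[OF core_ogroup] by auto
  have gen: "gen_convex \<Delta> \<gamma> = C \<inter> \<Delta>"
    using tilde_eq_gen_convex[OF C \<gamma>(1,2)] sub by (auto simp: gen_convex_def)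
  have "H \<subseteq> infinitesimals \<Gamma> \<gamma>"
    using infinitesimals_maximal[OF \<Gamma> convex_core \<gamma>(4,2)] .
  moreover have "\<not> H \<subset> infinitesimals \<Gamma> \<gamma>"
    \<comment> \<open>An infinitesimal group strictly above \<open>H\<close> would contain
      \<open>C\<close>, hence \<gamma> itself.\<close>
    using C not_mem_infinitesimals[of \<gamma> \<Gamma>] \<gamma>(1) convex_infinitesimals[OF \<Gamma> \<gamma>0]
    unfolding is_tilde_def by blast
  ultimately have "infinitesimals \<Gamma> \<gamma> = H"
    by blast
  moreover have "infinitesimals \<Delta> \<gamma> = infinitesimals \<Gamma> \<gamma> \<inter> \<Delta>"
    using sub by (auto simp: infinitesimals_def)
  ultimately have inf: "infinitesimals \<Delta> \<gamma> = H"
    using core_subset by blast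
  have "dense_ordered (oag (gen_convex \<Delta> \<gamma>) Mod infinitesimals \<Delta> \<gamma>) coset_less"
    using dense \<gamma>(3) \<gamma>0 archimedean_component_eq[OF \<Delta> \<gamma>(3) \<gamma>0]
    unfolding archimedean_components_dense_def by metis
  then have dense': "dense_ordered (oag (C \<inter> \<Delta>) Mod H) coset_less"
    by (simp add: gen inf)
  have C\<Delta>: "ogroup (C \<inter> \<Delta>)"
    using convex_subgroupD(2)[OF \<Delta> convex_gen_convex[OF \<Delta>, of \<gamma>]] by (simp add: gen)
  have HC\<Delta>: "convex_subgroup (C \<inter> \<Delta>) H"
    using convex_subgroup_between[OF \<Delta> convex_infinitesimals[OF \<Delta> \<gamma>0] convex_gen_convex[OF \<Delta>, of \<gamma>]]
      conv(2) core_subset by (auto simp: gen inf)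
  have "\<exists>c\<in>C. 0 < c \<and> c \<notin> H \<and> c < d \<and> d - c \<notin> H" if d: "d \<in> C" "0 < d" "d \<notin> H" for d
  proof -
    have "nsmul q d \<in> C \<inter> \<Delta>" "0 < nsmul q d" "nsmul q d \<notin> H"
      using d C' ogroup_nsmul nsmul_index_mem nsmul_not_mem_convex[OF C'(2) HC d(1,3) q0]
        le_nsmul[of d q] q0 by (auto intro: less_le_trans)
    \<comment> \<open>Cancelling \<open>q\<close> leaves \<open>nsmul 2 c \<le> d\<close>, so
      \<open>d - c\<close> is at least \<open>c\<close> and, like \<open>c\<close>, lies outside
      \<open>H\<close>.\<close>
    then obtain c where c: "c \<in> C \<inter> \<Delta>" "0 < c" "c \<notin> H" "nsmul (q * 2) c \<le> nsmul q d"
      using dense_quotient_divide[OF C\<Delta> HC\<Delta> dense'] by blast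
    have "nsmul 2 c \<le> d"
    proof (rule ccontr)
      assume "\<not> nsmul 2 c \<le> d"
      then have "nsmul q d < nsmul q (nsmul 2 c)"
        using nsmul_strict_mono[OF _ q0] by (simp only: not_le)
      then show False
        using c(4) by (simp add: nsmul_nsmul)
    qed
    then have cd: "c \<le> d - c"
      by (simp add: numeral_2_eq_2 algebra_simps)
    then have "c < d"
      using c(2) by (metis diff_gt_0_iff_gt less_le_trans)
    moreover have "d - c \<notin> H"
      using convex_subgroup_oabs[OF \<Gamma> convex_core, of "d - c" c] order_trans[OF cd le_oabs(1)] c sub
      by auto
    ultimately show ?thesis
      using c by blast
  qed
  then show ?thesis
    unfolding dense_quotient_iff[OF C'(2) HC] using conv(2) by blast
qed

end


section \<open>Valued fields\<close>

context valued_field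
begin

lemma v_zero [simp]: "v \<zero> = \<infinity>"
  using v_eq_Pinf by simp

lemma v_FinE:
  assumes "x \<in> carrier F" "x \<noteq> \<zero>"
  obtains \<gamma> where "v x = Fin \<gamma>"
  using assms v_not_Minf[of x] v_eq_Pinf[of x] by (cases "v x") auto

lemma v_one [simp]: "v \<one> = 0"
proof -
  obtain \<gamma> where "v \<one> = Fin \<gamma>"
    using v_FinE[of \<one>] by auto
  then show ?thesis
    using v_mult[of \<one> \<one>] by (simp add: zero_extended_def)
qed

lemma v_uminus: "x \<in> carrier F \<Longrightarrow> v (\<ominus> x) = v x"
proof -
  obtain \<gamma> where \<gamma>: "v (\<ominus> \<one>) = Fin \<gamma>"
    using v_FinE[of "\<ominus> \<one>"] by (metis add.inv_closed one_closed one_not_zero minus_minus minus_zero)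
  have "\<ominus> \<one> \<otimes> \<ominus> \<one> = \<one>"
    by (simp add: l_minus)
  then have "\<gamma> + \<gamma> = 0"
    using v_mult[of "\<ominus> \<one>" "\<ominus> \<one>"] \<gamma> by (simp add: zero_extended_def)
  \<comment> \<open>Ordered groups are torsion-free.\<close>
  then have "v (\<ominus> \<one>) = 0"
    using \<gamma> by (simp add: zero_extended_def)
  moreover assume "x \<in> carrier F"
  ultimately show ?thesis
    using v_mult[of "\<ominus> \<one>" x] by (simp add: l_minus)
qed

lemma v_inv:
  assumes "x \<in> carrier F" "x \<noteq> \<zero>" "v x = Fin \<gamma>"
  shows "v (inv x) = Fin (- \<gamma>)"
proof -
  have ix: "x \<otimes> inv x = \<one>" "inv x \<in> carrier F"
    using assms field_Units by auto
  then have "inv x \<noteq> \<zero>"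
    using assms by auto
  then obtain \<delta> where "v (inv x) = Fin \<delta>"
    using v_FinE ix by blast
  then show ?thesis
    using v_mult[OF assms(1) ix(2)] ix(1) assms(3) by (simp add: zero_extended_def eq_neg_iff_add_eq_0 add.commute)
qed

lemma v_pow: "x \<in> carrier F \<Longrightarrow> v x = Fin \<gamma> \<Longrightarrow> v (x [^] (n::nat)) = Fin (nsmul n \<gamma>)"
  by (induction n) (simp_all add: v_mult zero_extended_def add.commute)

lemma v_mult_Fin:
  "x \<in> carrier F \<Longrightarrow> y \<in> carrier F \<Longrightarrow> v x = Fin \<gamma> \<Longrightarrow> v y = Fin \<delta> \<Longrightarrow> v (x \<otimes> y) = Fin (\<gamma> + \<delta>)"
  by (simp add: v_mult)

lemma v_add_less:
  assumes "x \<in> carrier F" "y \<in> carrier F" "v x < v y"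
  shows "v (x \<oplus> y) = v x"
proof (rule antisym)
  \<comment> \<open>The ultrametric inequality for \<open>x\<close> written as the sum of
    \<open>x \<oplus> y\<close> and the negative of \<open>y\<close>.\<close>
  have "min (v (x \<oplus> y)) (v y) \<le> v x"
    using v_add[of "x \<oplus> y" "\<ominus> y"] assms by (simp add: v_uminus a_assoc r_neg)
  then show "v (x \<oplus> y) \<le> v x"
    using assms(3) by (auto simp: min_def split: if_splits)
  show "v x \<le> v (x \<oplus> y)"
    using v_add[OF assms(1,2)] assms(3) by (simp add: min_absorb1 less_imp_le)
qed

lemma v_add_eq_min:
  assumes "x \<in> carrier F" "y \<in> carrier F" "v x \<noteq> v y"
  shows "v (x \<oplus> y) = min (v x) (v y)"
  using v_add_less[OF assms(1,2)] v_add_less[OF assms(2,1)] assms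
  by (cases "v x" "v y" rule: linorder_cases) (auto simp: a_comm min_def)

lemma value_groupI: "x \<in> carrier F \<Longrightarrow> v x = Fin \<gamma> \<Longrightarrow> \<gamma> \<in> value_group F v"
  by (force simp: value_group_def)

lemma ogroup_value_group: "ogroup (value_group F v)"
proof (rule ogroupI)
  show "0 \<in> value_group F v"
    using value_groupI[of \<one> 0] by (simp add: zero_extended_def)
next
  fix a b assume "a \<in> value_group F v" "b \<in> value_group F v"
  then obtain x y where xy: "x \<in> carrier F" "v x = Fin a" "y \<in> carrier F" "y \<noteq> \<zero>" "v y = Fin b"
    by (auto simp: value_group_def)
  then have "inv y \<in> carrier F"
    using field_Units by auto
  then have "v (x \<otimes> inv y) = Fin (a - b)" "x \<otimes> inv y \<in> carrier F"
    using v_mult_Fin[OF xy(1) _ xy(2) v_inv[OF xy(3-5)]] xy(1) by auto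
  then show "a - b \<in> value_group F v"
    using value_groupI by blast
qed

lemma valuation_ring_subring: "subring (valuation_ring F v) F"
proof (rule subringI)
  fix x y assume "x \<in> valuation_ring F v" "y \<in> valuation_ring F v"
  then have xy: "x \<in> carrier F" "y \<in> carrier F" "0 \<le> v x" "0 \<le> v y"
    by (auto simp: valuation_ring_def)
  show "x \<otimes> y \<in> valuation_ring F v"
    using xy add_mono[OF xy(3,4)] by (simp add: valuation_ring_def v_mult)
  show "x \<oplus> y \<in> valuation_ring F v"
    using xy order_trans[OF _ v_add[of x y], of 0] by (simp add: valuation_ring_def)
qed (auto simp: valuation_ring_def v_uminus)

end

text \<open>(DRvg) excludes the infinite cyclic quotients that a non-dense archimedean component
  would produce.\<close>

lemma archimedean_components_dense_of_deeply_ramified: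
  assumes "deeply_ramified F w"
  shows "archimedean_components_dense (value_group F w)"
proof -
  interpret valued_field F w
    using assms by (simp add: deeply_ramified_def)
  show ?thesis
    using assms ogroup_value_group
    by (intro archimedean_components_denseI) (auto simp: deeply_ramified_def DRvg_def)
qed


section \<open>Extensions generated by an element whose value is not in the value group\<close>

locale valued_extension = valued_field L v
  for L :: "('a, 'm) ring_scheme" (structure) and v :: "'a \<Rightarrow> 'g::linordered_ab_group_add extended" +
  fixes K :: "'a set"
  assumes subfield: "subfield K L"
begin

abbreviation "\<Delta> \<equiv> value_group_sub L K v"
abbreviation "O\<^sub>K \<equiv> valuation_ring_sub L K v"

lemmas K_props = subringE[OF subfieldE(1)[OF subfield]]

lemma K_carrier: "c \<in> K \<Longrightarrow> c \<in> carrier L"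
  using K_props(1) by blast

lemma K_pow: "c \<in> K \<Longrightarrow> c [^] (n::nat) \<in> K"
  by (induction n) (use K_props in auto)

sublocale K: valued_field "L\<lparr>carrier := K\<rparr>" v
proof -
  interpret Kf: field "L\<lparr>carrier := K\<rparr>"
    using subfield_iff(2)[OF subfield] .
  show "valued_field (L\<lparr>carrier := K\<rparr>) v"
    by unfold_locales (auto simp: K_carrier v_not_Minf v_eq_Pinf v_mult v_add)
qed

lemma \<Delta>_iff: "\<gamma> \<in> \<Delta> \<longleftrightarrow> (\<exists>c\<in>K. c \<noteq> \<zero> \<and> v c = Fin \<gamma>)"
  by (auto simp: value_group_def)

lemma mem_\<Delta>: "c \<in> K \<Longrightarrow> v c = Fin \<gamma> \<Longrightarrow> \<gamma> \<in> \<Delta>"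
  by (force simp: value_group_def)

lemma \<Delta>_subset: "\<Delta> \<subseteq> value_group L v"
  using K_carrier by (auto simp: value_group_def)

lemma O\<^sub>K_iff: "c \<in> O\<^sub>K \<longleftrightarrow> c \<in> K \<and> 0 \<le> v c"
  by (auto simp: valuation_ring_def)

lemma O\<^sub>K_subring: "subring O\<^sub>K L"
proof -
  have "O\<^sub>K = K \<inter> valuation_ring L v"
    using K_carrier by (auto simp: valuation_ring_def)
  then show ?thesis
    using subring_inter[OF subfieldE(1)[OF subfield] valuation_ring_subring] by simp
qed

lemma divides_of_v_le:
  assumes "c \<in> K" "c' \<in> K" "v c' \<le> v c"
  obtains a where "a \<in> O\<^sub>K" "c = a \<otimes> c'"
proof (cases "c' = \<zero>")
  case True
  then have "c = \<zero>"
    using assms K_carrier v_eq_Pinf by simp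
  then show ?thesis
    using that[of \<zero>] True subringE(2)[OF O\<^sub>K_subring] by simp
next
  case False
  note c = K_carrier[OF assms(1)] K_carrier[OF assms(2)]
  have i: "inv c' \<in> K" "inv c' \<otimes> c' = \<one>"
    using subfield_m_inv[OF subfield, of c'] False assms(2) by auto
  obtain \<gamma> where \<gamma>: "v c' = Fin \<gamma>"
    using v_FinE[OF c(2) False] .
  have "v (c \<otimes> inv c') = v c + Fin (- \<gamma>)"
    using v_mult[OF c(1) K_carrier[OF i(1)]] v_inv[OF c(2) False \<gamma>] by simp
  then have "0 \<le> v (c \<otimes> inv c')"
    using assms(3) \<gamma> v_not_Minf[OF c(1)] by (cases "v c") (auto simp: zero_extended_def)
  moreover have "c \<otimes> inv c' \<in> K"
    using assms(1) i(1) K_props by blast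
  moreover have "c = c \<otimes> inv c' \<otimes> c'"
    using c K_carrier[OF i(1)] i(2) by (simp add: m_assoc)
  ultimately show ?thesis
    using that by (auto simp: O\<^sub>K_iff)
qed

lemma O_adjoin_subring: "y \<in> carrier L \<Longrightarrow> subring (O_adjoin L K v y) L"
  using simple_extension_is_subring[OF O\<^sub>K_subring] .

lemma O_adjoin_incl: "y \<in> carrier L \<Longrightarrow> O\<^sub>K \<subseteq> O_adjoin L K v y"
  using simple_extension_incl[OF subringE(1)[OF O\<^sub>K_subring]] .

lemma O_adjoin_mem: "y \<in> carrier L \<Longrightarrow> y \<in> O_adjoin L K v y"
  using simple_extension_mem[OF O\<^sub>K_subring] .

lemma O_adjoin_pow: "y \<in> carrier L \<Longrightarrow> y [^] (n::nat) \<in> O_adjoin L K v y"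
  using O_adjoin_mem subringE[OF O_adjoin_subring] by (induction n) auto

lemma O_adjoin_subset_valuation_ring:
  assumes "y \<in> carrier L" "0 < v y"
  shows "O_adjoin L K v y \<subseteq> valuation_ring L v"
proof (rule simple_extension_subring_incl[OF valuation_ring_subring])
  show "O\<^sub>K \<subseteq> valuation_ring L v" "y \<in> valuation_ring L v"
    using assms K_carrier less_imp_le by (auto simp: valuation_ring_def)
qed

text \<open>The quotient of \<open>c\<close> by \<open>c'\<close> is integral, so
  \<open>c \<otimes> x\<close> is an \<open>O\<^sub>K\<close>-multiple of
  \<open>c' \<otimes> x\<close>.\<close>

lemma O_adjoin_mono:
  assumes "x \<in> carrier L" "c \<in> K" "c' \<in> K" "v c' \<le> v c"
  shows "O_adjoin L K v (c \<otimes> x) \<subseteq> O_adjoin L K v (c' \<otimes> x)"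
proof -
  have y: "c' \<otimes> x \<in> carrier L"
    using assms K_carrier by auto
  obtain a where a: "a \<in> O\<^sub>K" "c = a \<otimes> c'"
    using divides_of_v_le[OF assms(2-4)] .
  then have "c \<otimes> x = a \<otimes> (c' \<otimes> x)"
    using assms K_carrier by (auto simp: O\<^sub>K_iff m_assoc)
  then have "c \<otimes> x \<in> O_adjoin L K v (c' \<otimes> x)"
    using a O_adjoin_incl[OF y] O_adjoin_mem[OF y] subringE(6)[OF O_adjoin_subring[OF y]] by auto
  then show ?thesis
    using simple_extension_subring_incl[OF O_adjoin_subring[OF y] O_adjoin_incl[OF y]] by blast
qed

text \<open>If \<open>v c < v c'\<close> while the inclusion holds, then
  \<open>c \<otimes> x\<close> is a multiple of \<open>c' \<otimes> x\<close> by an element of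
  nonnegative value, plus a constant from \<open>K\<close>. The first summand has too large a value,
  so the constant has the value of \<open>c \<otimes> x\<close>, which is not in \<Delta>.\<close>

lemma O_adjoin_ordered:
  assumes x: "x \<in> carrier L" "v x = Fin \<xi>" "\<xi> \<notin> \<Delta>"
  shows "O_adjoin_ordered L K v x"
proof -
  have "v c' \<le> v c" if c: "c \<in> K" "c' \<in> K" "0 < v (c' \<otimes> x)"
    and incl: "O_adjoin L K v (c \<otimes> x) \<subseteq> O_adjoin L K v (c' \<otimes> x)" for c c'
  proof (rule ccontr)
    assume "\<not> v c' \<le> v c"
    then have less: "v c < v c'" by simp
    note cL = K_carrier[OF c(1)] K_carrier[OF c(2)]
    obtain \<gamma> where \<gamma>: "v c = Fin \<gamma>"
      using less v_not_Minf[OF cL(1)] by (cases "v c") auto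
    have cx: "v (c \<otimes> x) = Fin (\<gamma> + \<xi>)"
      using v_mult_Fin[OF cL(1) x(1) \<gamma> x(2)] .
    have "\<gamma> \<in> \<Delta>"
      using mem_\<Delta>[OF c(1) \<gamma>] .
    then have n: "\<gamma> + \<xi> \<notin> \<Delta>"
      using ogroup_add_cancel[OF K.ogroup_value_group, of \<gamma> \<xi>] x(3) by (simp add: add.commute)
    have y: "c' \<otimes> x \<in> carrier L" "c \<otimes> x \<in> carrier L"
      using cL x by auto
    have y_less: "v (c \<otimes> x) < v (c' \<otimes> x)"
      using less \<gamma> x(2) v_mult[OF cL(2) x(1)] cx v_not_Minf[OF cL(2)] by (cases "v c'") auto
    have "c \<otimes> x \<in> O_adjoin L K v (c' \<otimes> x)"
      using incl O_adjoin_mem[OF y(2)] by blast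
    then show False
    \<comment> \<open>The outermost Horner step: the element is zero or
      \<open>b \<otimes> (c' \<otimes> x) \<oplus> a\<close>.\<close>
    proof (cases rule: simple_extension.cases)
      case zero
      then show ?thesis using cx by simp
    next
      case (lin b a)
      have ab: "a \<in> K" "b \<in> carrier L" "0 \<le> v b"
        using lin O_adjoin_subset_valuation_ring[OF y(1) c(3)] by (auto simp: valuation_ring_def)
      have "v (c' \<otimes> x) \<le> v (b \<otimes> (c' \<otimes> x))"
        using v_mult[OF ab(2) y(1)] add_right_mono[OF ab(3), of "v (c' \<otimes> x)"] by simp
      then have "v (c \<otimes> x) < v (\<ominus> (b \<otimes> (c' \<otimes> x)))"
        using y_less v_uminus[of "b \<otimes> (c' \<otimes> x)"] ab y by auto
      then have "v (c \<otimes> x \<oplus> \<ominus> (b \<otimes> (c' \<otimes> x))) = v (c \<otimes> x)"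
        using v_add_less ab y by auto
      moreover have "c \<otimes> x \<oplus> \<ominus> (b \<otimes> (c' \<otimes> x)) = a"
      proof -
        have s: "b \<otimes> (c' \<otimes> x) \<in> carrier L" "a \<in> carrier L"
          using ab y K_carrier by auto
        then show ?thesis
          unfolding lin(1) using r_neg1[OF s] a_comm[OF s(2), of "\<ominus> (b \<otimes> (c' \<otimes> x))"]
          by (simp add: a_comm[of _ "\<ominus> (b \<otimes> (c' \<otimes> x))"])
      qed
      ultimately have "v a = Fin (\<gamma> + \<xi>)"
        using cx by simp
      then show ?thesis
        using mem_\<Delta>[OF ab(1)] n by blast
    qed
  qed
  then show ?thesis
    unfolding O_adjoin_ordered_def using O_adjoin_mono[OF x(1)] by blast
qed

section \<open>Values of linear combinations\<close>

text \<open>By the sorting hypothesis, terms at different positions share a value only if it is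
  infinite. In the induction the head and the tail therefore have different values or both vanish.
  Inserting \<infinity> covers the empty combination.\<close>

lemma v_combine:
  assumes "length cs = length as" "set cs \<subseteq> K" "set as \<subseteq> carrier L"
    and "sorted_wrt (\<lambda>a b. \<forall>c\<in>K. \<forall>d\<in>K. v (c \<otimes> a) = v (d \<otimes> b) \<longrightarrow> v (c \<otimes> a) = \<infinity>) as"
  shows "v (combine cs as) = Min (insert \<infinity> (set (map2 (\<lambda>c a. v (c \<otimes> a)) cs as)))"
  using assms
proof (induction cs as rule: list_induct2)
  case Nil
  then show ?case by simp
next
  case (Cons c cs a as)
  let ?S = "set (map2 (\<lambda>c a. v (c \<otimes> a)) cs as)"
  have IH: "v (combine cs as) = Min (insert \<infinity> ?S)"
    using Cons by auto
  have ca: "c \<otimes> a \<in> carrier L" "combine cs as \<in> carrier L" "c \<in> K"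
    using Cons.prems K_props(1) by auto
  have "v (c \<otimes> a \<oplus> combine cs as) = min (v (c \<otimes> a)) (v (combine cs as))"
  proof (cases "v (c \<otimes> a) = v (combine cs as)")
    case False
    then show ?thesis
      using v_add_eq_min ca by blast
  next
    case eq: True
    have "v (c \<otimes> a) = \<infinity>"
    proof (rule ccontr)
      assume *: "v (c \<otimes> a) \<noteq> \<infinity>"
      have "Min (insert \<infinity> ?S) \<in> insert \<infinity> ?S"
        by (rule Min_in) auto
      then have "v (combine cs as) \<in> ?S"
        using IH eq * by auto
      then obtain d b where db: "d \<in> set cs" "b \<in> set as" "v (combine cs as) = v (d \<otimes> b)"
        by (auto dest: set_zip_leftD set_zip_rightD)
      then show False
        using Cons.prems eq * ca(3) by auto
    qed
    then show ?thesis
      using eq v_eq_Pinf ca by simp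
  qed
  then show ?case
    by (simp add: IH insert_commute[of \<infinity>])
qed

lemma combine_mem:
  assumes "length cs = length as" "\<zero> \<in> S" "\<And>a b. a \<in> S \<Longrightarrow> b \<in> S \<Longrightarrow> a \<oplus> b \<in> S"
    and "\<And>c a. (c, a) \<in> set (zip cs as) \<Longrightarrow> c \<otimes> a \<in> S"
  shows "combine cs as \<in> S"
  using assms by (induction cs as rule: list_induct2) auto

end

locale valued_extension_prime = valued_extension L v K
  for L :: "('a, 'm) ring_scheme" (structure) and v :: "'a \<Rightarrow> 'g::linordered_ab_group_add extended"
    and K +
  fixes q :: nat
  assumes q: "Factorial_Ring.prime q"
    and dim: "dimension q K (carrier L)"
    and index: "value_group_index L K v = q"
begin

abbreviation "\<Gamma> \<equiv> value_group L v"

sublocale G: prime_index \<Gamma> \<Delta> q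
  using ogroup_value_group K.ogroup_value_group \<Delta>_subset q index[unfolded value_group_index_def]
  by (rule prime_index.intro)

lemma H_core_eq: "H_core L K v = convex_core \<Gamma> \<Delta>"
  unfolding H_core_def by (rule G.greatest_convex_core)

lemma is_H_tilde_eq: "is_H_tilde L K v C \<longleftrightarrow> G.is_tilde C"
  unfolding is_H_tilde_def G.is_tilde_def H_core_eq ..

end

locale new_value_generator = valued_extension_prime +
  fixes x and \<xi> :: 'c
  assumes x: "x \<in> carrier L" and \<xi>: "v x = Fin \<xi>" "\<xi> \<notin> \<Delta>"
begin

lemma \<xi>_\<Gamma>: "\<xi> \<in> \<Gamma>"
  using value_groupI[OF x \<xi>(1)] .

lemma v_monomial:
  assumes "c \<in> K" "v c = Fin \<gamma>"
  shows "v (c \<otimes> x [^] (i::nat)) = Fin (\<gamma> + nsmul i \<xi>)"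
  using v_mult_Fin[OF K_carrier[OF assms(1)] nat_pow_closed[OF x] assms(2) v_pow[OF x \<xi>(1)]] .

text \<open>A common finite value would put \<open>nsmul (j - i) \<xi>\<close> into \<Delta>
  although \<open>0 < j - i < q\<close>.\<close>

lemma monomials_separated:
  assumes "c \<in> K" "d \<in> K" "i < j" "j < q" "v (c \<otimes> x [^] i) = v (d \<otimes> x [^] j)"
  shows "v (c \<otimes> x [^] i) = \<infinity>"
proof (cases "c = \<zero> \<or> d = \<zero>")
  case True
  then show ?thesis
    using assms(5) x by auto
next
  case False
  then obtain \<gamma> \<delta> where g: "v c = Fin \<gamma>" "v d = Fin \<delta>"
    using v_FinE K_carrier assms by metis
  have "nsmul j \<xi> = nsmul i \<xi> + nsmul (j - i) \<xi>"
    using assms(3) by (simp flip: nsmul_add)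
  then have "nsmul (j - i) \<xi> = \<gamma> - \<delta>"
    using assms(5) v_monomial[OF assms(1) g(1), of i] v_monomial[OF assms(2) g(2), of j]
    by (simp add: algebra_simps)
  then have "nsmul (j - i) \<xi> \<in> \<Delta>"
    using ogroup_diff[OF G.\<Delta> mem_\<Delta>[OF assms(1) g(1)] mem_\<Delta>[OF assms(2) g(2)]] by simp
  then have "q dvd j - i"
    using G.nsmul_mem_iff[OF \<xi>_\<Gamma> \<xi>(2)] by blast
  then show ?thesis
    using G.not_dvd_index[of "j - i"] assms by auto
qed

abbreviation "powers \<equiv> map (\<lambda>i. x [^] i) [0..<q]"

lemma powers_carrier: "set powers \<subseteq> carrier L"
  using x by auto

lemma powers_separated:
  "sorted_wrt (\<lambda>a b. \<forall>c\<in>K. \<forall>d\<in>K. v (c \<otimes> a) = v (d \<otimes> b) \<longrightarrow> v (c \<otimes> a) = \<infinity>) powers"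
  unfolding sorted_wrt_map
  by (rule sorted_wrt_mono_rel[OF _ sorted_wrt_upt]) (use monomials_separated in auto)

lemmas v_combine_powers = v_combine[OF _ _ powers_carrier powers_separated]

text \<open>A vanishing combination has infinite value. This is the minimum over its terms, so every
  term vanishes.\<close>

lemma independent_powers: "independent K powers"
proof (rule trivial_combine_imp_independent[OF subfield powers_carrier])
  fix cs assume cs: "set cs \<subseteq> K" "combine cs powers = \<zero>"
  \<comment> \<open>The coefficient list is truncated or padded with zeros to the length that
    \<open>v_combine\<close> demands.\<close>
  then obtain ds where ds: "set (take (length powers) cs) \<subseteq> set ds"
      "set ds \<subseteq> set (take (length powers) cs) \<union> {\<zero>}"
      "length ds = length powers" "combine ds powers = \<zero>"
    using combine_normalize[OF _ powers_carrier cs(2)] K_props(1) by blast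
  have dsK: "set ds \<subseteq> K"
    using ds(2) cs(1) K_props(2) set_take_subset[of "length powers" cs] by blast
  have "d = \<zero>" if d: "d \<in> set ds" for d
  proof -
    obtain a where a: "(d, a) \<in> set (zip ds powers)"
      using d ds(3) by (metis in_set_impl_in_set_zip1)
    then obtain i :: nat where i: "a = x [^] i"
      using set_zip_rightD[OF a] by auto
    have "Min (insert \<infinity> (set (map2 (\<lambda>c a. v (c \<otimes> a)) ds powers))) = \<infinity>"
      using v_combine_powers[OF ds(3) dsK] ds(4) by simp
    then have "\<infinity> \<le> v (d \<otimes> a)"
      using a Min_le[of "insert \<infinity> (set (map2 (\<lambda>c a. v (c \<otimes> a)) ds powers))" "v (d \<otimes> a)"] by force
    then have "v (d \<otimes> a) = \<infinity>"
      by simp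
    then show ?thesis
      using v_monomial[of d _ i] v_FinE[of d] K_carrier dsK d i by (metis extended.distinct(1) subsetD)
  qed
  then show "set (take (length powers) cs) \<subseteq> {\<zero>}"
    using ds(1) by blast
qed

text \<open>There are \<open>q\<close> independent powers in a space of dimension
  \<open>q\<close>.\<close>

lemma Span_powers: "Span K powers = carrier L"
  using independent_length_eq_dimension[OF subfield dim independent_powers powers_carrier] by simp

lemma valuation_basis_powers: "valuation_basis L K v powers"
proof -
  have "v (combine cs powers) = Min (set (map2 (\<lambda>c a. v (c \<otimes> a)) cs powers))"
    if "set cs \<subseteq> K" "length cs = length powers" for cs
  proof -
    let ?S = "set (map2 (\<lambda>c a. v (c \<otimes> a)) cs powers)"
    have "?S \<noteq> {}"
      using that(2) prime_gt_0_nat[OF q] by auto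
    \<comment> \<open>\<infinity> is the top element, and the set is nonempty since
      \<open>q > 0\<close>.\<close>
    then have "Min (insert \<infinity> ?S) = Min ?S"
      by (subst Min_insert) auto
    then show ?thesis
      using v_combine_powers[OF that(2,1)] by simp
  qed
  then show ?thesis
    unfolding valuation_basis_def using powers_carrier independent_powers Span_powers by blast
qed

section \<open>From value groups to (P1), (P2), (P3)\<close>

text \<open>By the valuation basis property every term in the expansion of an integral element is
  integral. So the valuation ring is additively generated by \<open>O\<^sub>K\<close> and
  \<open>A_set\<close>.\<close>

lemma valuation_ring_induct:
  assumes "\<zero> \<in> S" "\<And>a b. a \<in> S \<Longrightarrow> b \<in> S \<Longrightarrow> a \<oplus> b \<in> S" "O\<^sub>K \<subseteq> S" "A_set L K v q x \<subseteq> S"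
  shows "valuation_ring L v \<subseteq> S"
proof
  fix y assume "y \<in> valuation_ring L v"
  then have y: "y \<in> Span K powers" "0 \<le> v y"
    unfolding Span_powers by (auto simp: valuation_ring_def)
  then obtain cs where cs: "y = combine cs powers" "length cs = length powers" "set cs \<subseteq> K"
    unfolding Span_eq_combine_set_length_version[OF subfield powers_carrier] by blast
  have "combine cs powers \<in> S"
  proof (rule combine_mem[OF cs(2) assms(1,2)])
    fix c a assume ca: "(c, a) \<in> set (zip cs powers)"
    then obtain i :: nat where i: "a = x [^] i" "i < q"
      using set_zip_rightD[OF ca] by auto
    have c: "c \<in> K"
      using ca cs(3) by (auto dest: set_zip_leftD)
    have "v y \<le> v (c \<otimes> a)"
      unfolding cs(1) v_combine_powers[OF cs(2,3)] using ca by (intro Min_le) force+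
    then have pos: "0 \<le> v (c \<otimes> a)"
      using y(2) by (rule order_trans[rotated])
    consider "c = \<zero>" | "i = 0" | "c \<noteq> \<zero>" "1 \<le> i"
      by linarith
    then show "c \<otimes> a \<in> S"
    proof cases
      case 1
      then show ?thesis
        using assms(1) i x by simp
    next
      case 2
      then show ?thesis
        using pos i c assms(3) K_carrier by (auto simp: O\<^sub>K_iff)
    next
      case 3
      obtain \<gamma> where \<gamma>: "v c = Fin \<gamma>"
        using v_FinE[OF K_carrier[OF c] 3(1)] .
      \<comment> \<open>The value lies outside \<Delta>, so a nonnegative one is automatically
        positive.\<close>
      have "\<gamma> + nsmul i \<xi> \<noteq> 0"
        using G.coset_not_mem[OF \<xi>_\<Gamma> \<xi>(2) 3(2) i(2) mem_\<Delta>[OF c \<gamma>]] ogroup_zero[OF G.\<Delta>] by auto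
      then have "0 < v (c \<otimes> a)"
        using pos v_monomial[OF c \<gamma>, of i] i by (auto simp: zero_extended_def)
      then show ?thesis
        using assms(4) c 3 i by (auto simp: A_set_def)
    qed
  qed
  then show "y \<in> S"
    by (simp add: cs(1))
qed

text \<open>The inequality says that \<open>c [^] i\<close> divides \<open>d\<close> in
  \<open>O\<^sub>K\<close>.\<close>

lemma monomial_factor:
  assumes c: "c \<in> K" "v c = Fin \<epsilon>" and d: "d \<in> K" "v d = Fin \<delta>" and le: "nsmul i \<epsilon> \<le> \<delta>"
  shows "d \<otimes> x [^] i \<in> (\<lambda>a. (c \<otimes> x) [^] i \<otimes> a) ` O\<^sub>K"
proof -
  have "v (c [^] i) \<le> v d"
    using v_pow[OF K_carrier[OF c(1)] c(2), of i] d(2) le by simp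
  then obtain a where a: "a \<in> O\<^sub>K" "d = a \<otimes> c [^] i"
    using divides_of_v_le[OF d(1) K_pow[OF c(1)]] by blast
  then have "a \<in> carrier L" "c \<in> carrier L"
    using c K_carrier by (auto simp: O\<^sub>K_iff)
  then have "d \<otimes> x [^] i = (c \<otimes> x) [^] i \<otimes> a"
    using x by (simp add: a(2) nat_pow_distrib m_ac)
  then show ?thesis
    using a(1) by blast
qed

lemma monomial_mem_O_adjoin:
  assumes "c \<in> K" "y \<in> (\<lambda>a. (c \<otimes> x) [^] (i::nat) \<otimes> a) ` O\<^sub>K"
  shows "y \<in> O_adjoin L K v (c \<otimes> x)"
proof -
  have cx: "c \<otimes> x \<in> carrier L"
    using assms K_carrier x by auto
  obtain a where "a \<in> O\<^sub>K" "y = (c \<otimes> x) [^] i \<otimes> a"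
    using assms(2) by blast
  then show ?thesis
    using O_adjoin_pow[OF cx] O_adjoin_incl[OF cx] subringE(6)[OF O_adjoin_subring[OF cx]] by blast
qed

lemma A_setE:
  assumes "y \<in> A_set L K v q x"
  obtains d i \<delta> where "y = d \<otimes> x [^] i" "d \<in> K - {\<zero>}" "v d = Fin \<delta>" "1 \<le> i" "i < q" "0 < \<delta> + nsmul i \<xi>"
proof -
  obtain d i where d: "y = d \<otimes> x [^] i" "d \<in> K - {\<zero>}" "1 \<le> i" "i < q" "0 < v y"
    using assms by (auto simp: A_set_def)
  then obtain \<delta> where "v d = Fin \<delta>"
    using v_FinE K_carrier by (metis DiffD1 DiffD2 singletonI)
  with that d show ?thesis
    using v_monomial[of d \<delta> i] by (auto simp: zero_extended_def)
qed

text \<open>\<open>divisible_below\<close> is (P3) read off on values, with \<delta> and \<epsilon>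
  the values of \<open>d\<close> and \<open>c\<close>.\<close>

lemma P3:
  assumes "G.divisible_below \<xi>"
  shows "P3 L K v q x"
  unfolding P3_def
proof (intro ballI allI impI, elim conjE)
  fix d i assume d: "d \<in> K - {\<zero>}" "1 \<le> i" "i < q" "d \<otimes> x [^] i \<in> A_set L K v q x"
  obtain \<delta> where \<delta>: "v d = Fin \<delta>"
    using v_FinE[of d] d K_carrier by auto
  have "0 < v (d \<otimes> x [^] i)"
    using d(4) by (auto simp: A_set_def)
  then have "0 < \<delta> + nsmul i \<xi>"
    using v_monomial[OF _ \<delta>] d by (simp add: zero_extended_def)
  then obtain \<epsilon> where \<epsilon>: "\<epsilon> \<in> \<Delta>" "0 < \<epsilon> + \<xi>" "nsmul i \<epsilon> \<le> \<delta>"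
    using assms d mem_\<Delta>[OF _ \<delta>] unfolding G.divisible_below_def by blast
  then obtain c where c: "c \<in> K" "c \<noteq> \<zero>" "v c = Fin \<epsilon>"
    using \<Delta>_iff by blast
  have "c \<otimes> x = c \<otimes> x [^] (1::nat)"
    using x by simp
  moreover have "0 < v (c \<otimes> x [^] (1::nat))"
    using v_monomial[OF c(1,3), of 1] \<epsilon>(2) by (simp add: zero_extended_def)
  ultimately have "c \<otimes> x \<in> A_set L K v q x"
    using c prime_gt_1_nat[OF q] unfolding A_set_def by blast
  then show "\<exists>c\<in>K. c \<otimes> x \<in> A_set L K v q x \<and> d \<otimes> x [^] i \<in> (\<lambda>a. (c \<otimes> x) [^] i \<otimes> a) ` O\<^sub>K"
    using monomial_factor[OF c(1,3) _ \<delta> \<epsilon>(3)] c(1) d(1) by blast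
qed

lemma P2_of_P3:
  assumes "P3 L K v q x"
  shows "P2 L K v q x"
  unfolding P2_def
proof
  fix y assume y: "y \<in> A_set L K v q x"
  then obtain d i where "y = d \<otimes> x [^] i" "d \<in> K - {\<zero>}" "1 \<le> i" "i < q"
    by (rule A_setE)
  then obtain c where c: "c \<in> K" "c \<otimes> x \<in> A_set L K v q x" "y \<in> (\<lambda>a. (c \<otimes> x) [^] i \<otimes> a) ` O\<^sub>K"
    using assms y unfolding P3_def by metis
  moreover have "0 < v (c \<otimes> x)"
    using c(2) by (auto simp: A_set_def)
  ultimately show "y \<in> O_adjoin_union L K v x"
    using monomial_mem_O_adjoin[OF c(1,3)] unfolding O_adjoin_union_def by blast
qed

text \<open>The rings in the union form a chain, so the union is closed under addition and
  \<open>valuation_ring_induct\<close> applies.\<close>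

lemma P1_of_P2:
  assumes "P2 L K v q x"
  shows "P1 L K v x"
  unfolding P1_def
proof
  have zero: "\<zero> \<in> K" "0 < v (\<zero> \<otimes> x)"
    using K_props(2) x by (auto simp: zero_extended_def)
  show "valuation_ring L v \<subseteq> O_adjoin_union L K v x"
  proof (rule valuation_ring_induct)
    have "O\<^sub>K \<subseteq> O_adjoin L K v (\<zero> \<otimes> x)"
      using O_adjoin_incl[of "\<zero> \<otimes> x"] x by auto
    then show "O\<^sub>K \<subseteq> O_adjoin_union L K v x"
      unfolding O_adjoin_union_def using zero by blast
    then show "\<zero> \<in> O_adjoin_union L K v x"
      using subringE(2)[OF O\<^sub>K_subring] by blast
  next
    fix a b assume "a \<in> O_adjoin_union L K v x" "b \<in> O_adjoin_union L K v x"
    then obtain c d where cd: "c \<in> K" "0 < v (c \<otimes> x)" "a \<in> O_adjoin L K v (c \<otimes> x)"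
        "d \<in> K" "0 < v (d \<otimes> x)" "b \<in> O_adjoin L K v (d \<otimes> x)"
      unfolding O_adjoin_union_def by blast
    define e where "e = (if v c \<le> v d then c else d)"
    have e: "e \<in> K" "0 < v (e \<otimes> x)" "v e \<le> v c" "v e \<le> v d"
      using cd by (auto simp: e_def)
    then have "a \<in> O_adjoin L K v (e \<otimes> x)" "b \<in> O_adjoin L K v (e \<otimes> x)"
      using O_adjoin_mono[OF x] cd by blast+
    moreover have "e \<otimes> x \<in> carrier L"
      using e(1) K_carrier x by auto
    ultimately have "a \<oplus> b \<in> O_adjoin L K v (e \<otimes> x)"
      using subringE(7)[OF O_adjoin_subring] by blast
    then show "a \<oplus> b \<in> O_adjoin_union L K v x"
      unfolding O_adjoin_union_def using e by blast
  next
    show "A_set L K v q x \<subseteq> O_adjoin_union L K v x"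
      using assms by (simp add: P2_def)
  qed
  show "O_adjoin_union L K v x \<subseteq> valuation_ring L v"
    using O_adjoin_subset_valuation_ring K_carrier x unfolding O_adjoin_union_def by blast
qed

text \<open>When one \<epsilon> serves all \<open>i\<close> and \<delta> simultaneously, a single
  ring already contains \<open>A_set\<close>.\<close>

lemma valuation_ring_eq_O_adjoin:
  assumes c: "c \<in> K" "v c = Fin \<epsilon>" and pos: "0 < \<epsilon> + \<xi>"
    and le: "\<And>i \<delta>. 1 \<le> i \<Longrightarrow> i < q \<Longrightarrow> \<delta> \<in> \<Delta> \<Longrightarrow> 0 < \<delta> + nsmul i \<xi> \<Longrightarrow> nsmul i \<epsilon> \<le> \<delta>"
  shows "valuation_ring L v = O_adjoin L K v (c \<otimes> x)"
proof
  have cx: "c \<otimes> x \<in> carrier L" "0 < v (c \<otimes> x)"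
    using K_carrier[OF c(1)] x v_mult_Fin[OF K_carrier[OF c(1)] x c(2) \<xi>(1)] pos
    by (auto simp: zero_extended_def)
  note S = subringE[OF O_adjoin_subring[OF cx(1)]]
  show "valuation_ring L v \<subseteq> O_adjoin L K v (c \<otimes> x)"
  proof (rule valuation_ring_induct[OF S(2,7) O_adjoin_incl[OF cx(1)]])
    show "A_set L K v q x \<subseteq> O_adjoin L K v (c \<otimes> x)"
    proof
      fix y assume "y \<in> A_set L K v q x"
      then obtain d i \<delta> where d: "y = d \<otimes> x [^] i" "d \<in> K - {\<zero>}" "v d = Fin \<delta>"
          "1 \<le> i" "i < q" "0 < \<delta> + nsmul i \<xi>"
        by (rule A_setE)
      then have "nsmul i \<epsilon> \<le> \<delta>"
        using le mem_\<Delta> by blast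
      then show "y \<in> O_adjoin L K v (c \<otimes> x)"
        using monomial_mem_O_adjoin[OF c(1)] monomial_factor[OF c _ d(3)] d(1,2) by blast
    qed
  qed
  show "O_adjoin L K v (c \<otimes> x) \<subseteq> valuation_ring L v"
    using O_adjoin_subset_valuation_ring[OF cx] .
qed

end

theorem theorem3p3:
  fixes L :: "('a, 'm) ring_scheme" (structure)
    and K :: "'a set"
    and v :: "'a \<Rightarrow> 'g::linordered_ab_group_add extended"
    and q :: nat and x\<^sub>0 :: 'a
  assumes "valued_field L v" and "subfield K L"
    and "Factorial_Ring.prime q"
    and "ring.dimension L q K (carrier L)"
    and "value_group_index L K v = q"
    and "x\<^sub>0 \<in> carrier L - {\<zero>}" and "v x\<^sub>0 \<notin> Fin ` value_group_sub L K v"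
  shows
    "(DL2a L K v \<or> DL2b L K v \<longrightarrow>
        P1 L K v x\<^sub>0 \<and> P2 L K v q x\<^sub>0 \<and> P3 L K v q x\<^sub>0 \<and>
        valuation_basis L K v (map (\<lambda>i. x\<^sub>0 [^] i) [0..<q]) \<and>
        O_adjoin_ordered L K v x\<^sub>0) \<and>
     (DL2c L K v \<longrightarrow>
        (\<exists>j\<in>{1..q-1}. let x = x\<^sub>0 [^] j in
           P1 L K v x \<and> P2 L K v q x \<and> P3 L K v q x \<and>
           (H_core L K v = {0} \<longrightarrow>
              (\<exists>c\<in>K. valuation_ring L v = O_adjoin L K v (c \<otimes> x))) \<and>
           valuation_basis L K v (map (\<lambda>i. x [^] i) [0..<q]) \<and>
           O_adjoin_ordered L K v x)) \<and>
     (archimedean_components_dense (value_group_sub L K v) \<longrightarrow> DL2a L K v \<or> DL2b L K v) \<and>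
     (\<forall>(F :: ('c, 'n) ring_scheme) (w :: 'c \<Rightarrow> 'h::linordered_ab_group_add extended).
        deeply_ramified F w \<longrightarrow> archimedean_components_dense (value_group F w))"
proof -
  interpret valued_field L v by fact
  interpret valued_extension_prime L v K q
    by (intro valued_extension_prime.intro valued_extension.intro valued_extension_axioms.intro
        valued_extension_prime_axioms.intro) fact+
  obtain \<xi> where \<xi>: "v x\<^sub>0 = Fin \<xi>"
    using v_FinE assms(6) by blast
  interpret x\<^sub>0: new_value_generator L v K q x\<^sub>0 \<xi>
    using assms(6,7) \<xi> by unfold_locales auto
  have part1: "G.divisible_below \<xi>" if "DL2a L K v \<or> DL2b L K v"
    using that G.divisible_below_DL2a[OF _ x\<^sub>0.\<xi>_\<Gamma> x\<^sub>0.\<xi>(2)]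
      G.divisible_below_DL2b[OF _ _ x\<^sub>0.\<xi>_\<Gamma> x\<^sub>0.\<xi>(2)]
    unfolding DL2a_def DL2b_def is_H_tilde_eq H_core_eq by blast
  have part2: "\<exists>j\<in>{1..q-1}. let x = x\<^sub>0 [^] j in
           P1 L K v x \<and> P2 L K v q x \<and> P3 L K v q x \<and>
           (H_core L K v = {0} \<longrightarrow>
              (\<exists>c\<in>K. valuation_ring L v = O_adjoin L K v (c \<otimes> x))) \<and>
           valuation_basis L K v (map (\<lambda>i. x [^] i) [0..<q]) \<and>
           O_adjoin_ordered L K v x" if discr: "DL2c L K v"
  proof -
    obtain C where "G.is_tilde C" "discrete_ordered (oag C Mod convex_core \<Gamma> \<Delta>) coset_less"
      using discr unfolding DL2c_def is_H_tilde_eq H_core_eq by blast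
    then obtain e j where e: "e \<in> \<Gamma>" "0 < e" "1 \<le> j" "j < q" "e - nsmul j \<xi> \<in> \<Delta>"
      and below: "\<And>i \<alpha>. 1 \<le> i \<Longrightarrow> i < q \<Longrightarrow> \<alpha> \<in> \<Gamma> \<Longrightarrow> 0 < \<alpha> \<Longrightarrow> \<alpha> - nsmul i e \<in> \<Delta> \<Longrightarrow>
        \<exists>h\<in>convex_core \<Gamma> \<Delta>. h < e \<and> nsmul i (e - h) \<le> \<alpha>"
      using G.DL2c_generator[OF _ _ x\<^sub>0.\<xi>_\<Gamma> x\<^sub>0.\<xi>(2)] by metis
    define \<eta> where "\<eta> = nsmul j \<xi>"
    have \<eta>: "v (x\<^sub>0 [^] j) = Fin \<eta>" "\<eta> \<notin> \<Delta>" "e - \<eta> \<in> \<Delta>"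
      using v_pow[OF x\<^sub>0.x \<xi>] G.nsmul_mem_iff[OF x\<^sub>0.\<xi>_\<Gamma> x\<^sub>0.\<xi>(2)] G.not_dvd_index[OF e(3,4)] e(5)
      by (auto simp: \<eta>_def)
    interpret x: new_value_generator L v K q "x\<^sub>0 [^] j" \<eta>
      using \<eta> x\<^sub>0.x by unfold_locales auto
    \<comment> \<open>The bound from \<open>DL2c_generator\<close> with
      \<open>nsmul i \<eta>\<close> moved to the other side; the witness for
      \<open>divisible_below\<close> is \<open>e - h - \<eta>\<close>.\<close>
    have below': "\<exists>h\<in>convex_core \<Gamma> \<Delta>. h < e \<and> nsmul i (e - h - \<eta>) \<le> \<delta>"
      if i: "1 \<le> i" "i < q" "\<delta> \<in> \<Delta>" "0 < \<delta> + nsmul i \<eta>" for i \<delta>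
    proof -
      have "\<delta> + nsmul i \<eta> \<in> \<Gamma>"
        using i(3) \<Delta>_subset ogroup_add[OF G.\<Gamma>] ogroup_nsmul[OF G.\<Gamma> x.\<xi>_\<Gamma>] by blast
      moreover have "\<delta> + nsmul i \<eta> - nsmul i e \<in> \<Delta>"
        using ogroup_diff[OF G.\<Delta> i(3) ogroup_nsmul[OF G.\<Delta> \<eta>(3), of i]]
        by (simp add: nsmul_diff algebra_simps)
      ultimately obtain h where "h \<in> convex_core \<Gamma> \<Delta>" "h < e" "nsmul i (e - h) \<le> \<delta> + nsmul i \<eta>"
        using below i by blast
      then show ?thesis
        by (intro bexI[of _ h]) (auto simp: nsmul_diff diff_le_eq)
    qed
    have "G.divisible_below \<eta>"
      unfolding G.divisible_below_def
    proof (intro allI impI, elim conjE)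
      fix i \<delta> assume "1 \<le> i" "i < q" "\<delta> \<in> \<Delta>" "0 < \<delta> + nsmul i \<eta>"
      then obtain h where h: "h \<in> convex_core \<Gamma> \<Delta>" "h < e" "nsmul i (e - h - \<eta>) \<le> \<delta>"
        using below' by blast
      have "e - h - \<eta> \<in> \<Delta>"
        using ogroup_diff[OF G.\<Delta> \<eta>(3), of h] h(1) G.core_subset by (auto simp: algebra_simps)
      then show "\<exists>\<epsilon>\<in>\<Delta>. 0 < \<epsilon> + \<eta> \<and> nsmul i \<epsilon> \<le> \<delta>"
        using h by (intro bexI[of _ "e - h - \<eta>"]) auto
    qed
    then have P: "P3 L K v q (x\<^sub>0 [^] j)"
      by (rule x.P3)
    have "\<exists>c\<in>K. valuation_ring L v = O_adjoin L K v (c \<otimes> x\<^sub>0 [^] j)" if "H_core L K v = {0}"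
    proof -
      obtain c where c: "c \<in> K" "v c = Fin (e - \<eta>)"
        using \<eta>(3) \<Delta>_iff by blast
      \<comment> \<open>A trivial core forces \<open>h = 0\<close>, so the witness no longer depends
        on \<open>i\<close> and \<delta>.\<close>
      have "nsmul i (e - \<eta>) \<le> \<delta>" if "1 \<le> i" "i < q" "\<delta> \<in> \<Delta>" "0 < \<delta> + nsmul i \<eta>" for i \<delta>
        using below'[OF that] \<open>H_core L K v = {0}\<close> by (auto simp: H_core_eq)
      then show ?thesis
        using x.valuation_ring_eq_O_adjoin[OF c] e(2) c(1) by auto
    qed
    then show ?thesis
      using P x.P2_of_P3 x.P1_of_P2 x.valuation_basis_powers O_adjoin_ordered[OF x.x x.\<xi>] e(3,4)
      by (intro bexI[of _ j]) (auto simp: Let_def)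
  qed
  \<comment> \<open>Either no smallest convex subgroup above the core exists, or its quotient by the
    core is dense.\<close>
  have part3: "DL2a L K v \<or> DL2b L K v" if "archimedean_components_dense \<Delta>"
    using G.dense_tilde_quotient[OF that]
    unfolding DL2a_def DL2b_def is_H_tilde_eq H_core_eq by blast
  show ?thesis
    using part1 part2 part3 x\<^sub>0.P3 x\<^sub>0.P2_of_P3 x\<^sub>0.P1_of_P2 x\<^sub>0.valuation_basis_powers
      O_adjoin_ordered[OF x\<^sub>0.x x\<^sub>0.\<xi>] archimedean_components_dense_of_deeply_ramified
    by blast
qed

end
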